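(* Let $0<q<1$, $n\in\mathbb N_0$, $\alpha,\beta\in(-1,\infty)$, and $t\in\mathbb C$ with $|t|<(1-q^{\alpha+1})(1-q)$. Then $$\int_0^\infty{}_0\phi_2\!\left(-;q^{\alpha+1},t;q,-xtq^{\alpha+1}\right)L_n^{(\beta)}(x;q)\frac{x^\beta}{(-x;q)_\infty}\,dx=\frac{-\left(-tq^{\alpha-\beta}\right)^nq^{\binom n2}}{q^n(t;q)_\infty(q^{\alpha+1};q)_n}\;{}_1\phi_1\!\left(q^{\alpha-\beta};q^{\alpha+n+1};q,tq^n\right)\,M_n(\beta),$$ where $$M_n(\beta)=\begin{cases}\dfrac{\pi(q^{-\beta};q)_\infty(q^{\beta+1};q)_n}{\sin(\pi\beta)(q;q)_\infty(q;q)_n},&\beta\in(-1,\infty)\setminus\mathbb N_0,\\[3mm]\dfrac{(q^{n+1};q)_\beta\log q}{q^{\beta(\beta+1)/2}},&\beta\in\mathbb N_0.\end{cases}$$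
   Context: Notation: $\mathbb N_0=\{0,1,2,\dots\}$, $(a;q)_0=1$, $(a;q)_n=\prod_{j=0}^{n-1}(1-aq^j)$, $(a;q)_\infty=\prod_{j\ge0}(1-aq^j)$, $(a_1,\dots,a_r;q)_n=\prod_i(a_i;q)_n$. The basic hypergeometric series, with upper parameters listed before the first semicolon and lower parameters before the second (a dash denotes an empty list), is $${}_r\phi_s(a_1,\dots,a_r;b_1,\dots,b_s;q,z)=\sum_{k=0}^\infty\frac{(a_1,\dots,a_r;q)_k}{(q,b_1,\dots,b_s;q)_k}\left((-1)^kq^{\binom k2}\right)^{1+s-r}z^k.$$ The $q$-Laguerre polynomials are $$L_n^{(\alpha)}(x;q)=\frac{(q^{\alpha+1};q)_n}{(q;q)_n}\,{}_1\phi_1\!\left(q^{-n};q^{\alpha+1};q,-q^{n+\alpha+1}x\right).$$ *)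

theory Defs
  imports "HOL-Analysis.Analysis"
begin

definition qpoch :: "complex \<Rightarrow> complex \<Rightarrow> nat \<Rightarrow> complex" where
  "qpoch a q n = (\<Prod>j<n. 1 - a * q ^ j)"

definition qpoch_inf :: "complex \<Rightarrow> complex \<Rightarrow> complex" where
  "qpoch_inf a q = (\<Prod>j. 1 - a * q ^ j)"

text \<open>
  The basic hypergeometric series with upper parameters \<open>as\<close> and lower parameters \<open>bs\<close>.
  The exponent \<open>1 + s - r\<close> may be negative, hence the integer power.
\<close>

definition qhyp :: "complex list \<Rightarrow> complex list \<Rightarrow> complex \<Rightarrow> complex \<Rightarrow> complex" where
  "qhyp as bs q z =
     (\<Sum>k. (\<Prod>a\<leftarrow>as. qpoch a q k) / (qpoch q q k * (\<Prod>b\<leftarrow>bs. qpoch b q k))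
          * ((-1) ^ k * q ^ (k choose 2)) powi (1 + int (length bs) - int (length as)) * z ^ k)"

definition q_laguerre :: "nat \<Rightarrow> real \<Rightarrow> real \<Rightarrow> complex \<Rightarrow> complex" where
  "q_laguerre n \<alpha> q x =
     qpoch (of_real (q powr (\<alpha> + 1))) (of_real q) n / qpoch (of_real q) (of_real q) n
     * qhyp [of_real (q powr (- real n))] [of_real (q powr (\<alpha> + 1))] (of_real q)
         (- of_real (q powr (real n + \<alpha> + 1)) * x)"

text \<open>
  The factor \<open>M\<^sub>n(\<beta>)\<close>. For \<open>\<beta> \<in> \<nat>\<close> the generic formula degenerates to \<open>0 / 0\<close>; there
  \<open>\<beta>\<close> also serves as the length of a finite \<open>q\<close>-shifted factorial, written \<open>nat \<lfloor>\<beta>\<rfloor>\<close>.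
\<close>

definition qlag_factor :: "real \<Rightarrow> nat \<Rightarrow> real \<Rightarrow> complex" where
  "qlag_factor q n \<beta> =
     (if \<beta> \<in> \<nat>
      then qpoch (of_real (q ^ (n + 1))) (of_real q) (nat \<lfloor>\<beta>\<rfloor>) * of_real (ln q)
           / of_real (q powr (\<beta> * (\<beta> + 1) / 2))
      else of_real pi * qpoch_inf (of_real (q powr (- \<beta>))) (of_real q)
             * qpoch (of_real (q powr (\<beta> + 1))) (of_real q) n
           / (of_real (sin (pi * \<beta>)) * qpoch_inf (of_real q) (of_real q)
             * qpoch (of_real q) (of_real q) n))"

end

theory Submission
  imports Defs
begin

text \<open>
  The weight \<open>w x = 1 / (-x; q)\<^sub>\<infinity>\<close> satisfies \<open>w (q x) = (1 + x) w x\<close>, so its moments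
  \<open>\<mu>\<^sub>m = \<integral> x\<^sup>\<beta>\<^sup>+\<^sup>m w x dx\<close> obey \<open>\<mu>\<^sub>m\<^sub>+\<^sub>1 = (q\<^sup>-\<^sup>\<beta>\<^sup>-\<^sup>m\<^sup>-\<^sup>1 - 1) \<mu>\<^sub>m\<close>, and everything is determined by
  \<open>\<mu>\<^sub>0 = - M\<^sub>0(\<beta>)\<close>. That value (\<open>moment_mellin_kernel_inf\<close>) comes from the finite products
  \<open>1 / (-x; q)\<^sub>N\<close>: a dilation again yields a first-order recurrence in \<open>N\<close>, which starts at a Beta
  integral or, at \<open>\<beta> = 0\<close>, at an elementary logarithm.

  The series \<open>\<^sub>0\<phi>\<^sub>2\<close> has terms of order \<open>q\<^sup>3\<^sup>k\<^sup>(\<^sup>k\<^sup>-\<^sup>1\<^sup>)\<^sup>/\<^sup>2\<close>, the moments grow only like \<open>q\<^sup>-\<^sup>k\<^sup>(\<^sup>k\<^sup>+\<^sup>1\<^sup>)\<^sup>/\<^sup>2\<close> up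
  to exponential factors, so the integral may be taken term by term. The integral of \<open>x\<^sup>k\<close> against the
  \<open>q\<close>-Laguerre polynomial and its weight is a \<open>q\<close>-Chu-Vandermonde sum (\<open>laguerre_moment\<close>) with
  value \<open>\<mu>\<^sub>k (q\<^sup>-\<^sup>k; q)\<^sub>n / (q; q)\<^sub>n\<close>; it vanishes for \<open>k < n\<close>. The terms \<open>k = n + m\<close> that remain
  form the series
  \<open>\<Sum>\<^sub>m q\<^sup>m\<^sup>(\<^sup>m\<^sup>-\<^sup>1\<^sup>) (C/A; q)\<^sub>m (A z)\<^sup>m / ((q; q)\<^sub>m (C; q)\<^sub>m (z; q)\<^sub>m)\<close> with \<open>A = q\<^sup>\<alpha>\<^sup>-\<^sup>\<beta>\<close>, \<open>C = q\<^sup>\<alpha>\<^sup>+\<^sup>n\<^sup>+\<^sup>1\<close> and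
  \<open>z = t q\<^sup>n\<close>, which is \<open>\<^sub>1\<phi>\<^sub>1(A; C; q, z) / (z; q)\<^sub>\<infinity>\<close> by \<open>one_phi_one_transformation\<close>. The proof
  of that transformation expands an infinite product and sums along diagonals, where the same
  \<open>q\<close>-Chu-Vandermonde identity (\<open>q_chu_vandermonde\<close>) appears a second time.
\<close>

section \<open>Finite q-shifted factorials\<close>

lemma qpoch_0 [simp]: "qpoch a q 0 = 1"
  by (simp add: qpoch_def)

lemma qpoch_Suc: "qpoch a q (Suc n) = qpoch a q n * (1 - a * q ^ n)"
  by (simp add: qpoch_def)

lemma qpoch_add: "qpoch a q (m + n) = qpoch a q m * qpoch (a * q ^ m) q n"
  by (induction n) (simp_all add: qpoch_Suc power_add mult_ac)

lemma qpoch_Suc_left: "qpoch a q (Suc n) = (1 - a) * qpoch (a * q) q n"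
  using qpoch_add[of a q 1 n] by (simp add: qpoch_Suc)

section \<open>Gaussian binomials and the q-Chu-Vandermonde sum\<close>

text \<open>
  The Gaussian binomial coefficient, given by its Pascal rule. Unlike the quotient of
  \<open>q\<close>-factorials, this makes sense for every \<open>q\<close>, roots of unity included, and it vanishes for
  \<open>k > n\<close> by itself.
\<close>

fun qbinom :: "complex \<Rightarrow> nat \<Rightarrow> nat \<Rightarrow> complex" where
  "qbinom q n 0 = 1"
| "qbinom q 0 (Suc k) = 0"
| "qbinom q (Suc n) (Suc k) = q ^ Suc k * qbinom q n (Suc k) + qbinom q n k"

lemma qbinom_eq_0: "n < k \<Longrightarrow> qbinom q n k = 0"
  by (induction q n k rule: qbinom.induct) auto

lemma qbinom_self [simp]: "qbinom q n n = 1"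
  by (induction n) (auto simp: qbinom_eq_0)

lemma qbinom_mult_qpoch:
  "k \<le> n \<Longrightarrow> qbinom q n k * qpoch q q k * qpoch q q (n - k) = qpoch q q n"
proof (induction q n k rule: qbinom.induct)
  case (3 q n k)
  show ?case
  proof (cases "k = n")
    case True
    then show ?thesis by (simp add: qbinom_eq_0)
  next
    case False
    with 3 have "k < n" by simp
    then obtain d where d: "n = Suc (k + d)" using less_imp_Suc_add by blast
    have IH1: "qbinom q n (Suc k) * qpoch q q (Suc k) * qpoch q q d = qpoch q q n"
      using 3(1) d by simp
    have IH2: "qbinom q n k * qpoch q q k * qpoch q q (Suc d) = qpoch q q n"
      using 3(2) d by simp
    have "qbinom q (Suc n) (Suc k) * qpoch q q (Suc k) * qpoch q q (Suc n - Suc k) =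
        q ^ Suc k * (1 - q ^ Suc d) * (qbinom q n (Suc k) * qpoch q q (Suc k) * qpoch q q d)
        + (1 - q ^ Suc k) * (qbinom q n k * qpoch q q k * qpoch q q (Suc d))"
      by (simp add: d qpoch_Suc algebra_simps)
    also have "\<dots> = (q ^ Suc k * (1 - q ^ Suc d) + (1 - q ^ Suc k)) * qpoch q q n"
      unfolding IH1 IH2 by (simp add: algebra_simps)
    also have "q ^ Suc k * (1 - q ^ Suc d) + (1 - q ^ Suc k) = 1 - q * q ^ n"
      by (simp add: d power_add algebra_simps)
    finally show ?thesis by (simp add: qpoch_Suc)
  qed
qed auto

lemma choose_two_Suc: "(Suc m choose 2) = (m choose 2) + m"
  by (simp add: numeral_2_eq_2)

text \<open>
  The terminating \<open>q\<close>-Chu-Vandermonde sum, cleared of denominators: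
  dividing by \<open>qpoch c q N\<close> gives \<open>\<^sub>2\<phi>\<^sub>1(q\<^sup>-\<^sup>N, c/a; c; q, a q\<^sup>N) = (a; q)\<^sub>N / (c; q)\<^sub>N\<close>.
  In this polynomial form the parameters may be scaled freely, which is what the induction uses:
  the Pascal rule pairs the \<open>m\<close>-th with the \<open>(m + 1)\<close>-st product, their common factor is
  \<open>(1 - c q\<^sup>m) - (a - c q\<^sup>m) = 1 - a\<close>, independent of \<open>m\<close>, and what remains is the sum of length
  \<open>N\<close> at \<open>(a q, c q)\<close>. For \<open>c = 0\<close> it is the finite \<open>q\<close>-binomial theorem.
\<close>

theorem q_chu_vandermonde:
  "(\<Sum>m\<le>N. qbinom q N m * (-1) ^ m * q ^ (m choose 2)
      * (\<Prod>i<m. a - c * q ^ i) * qpoch (c * q ^ m) q (N - m)) = qpoch a q N"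
proof (induction N arbitrary: a c)
  case (Suc N)
  define T where "T = (\<lambda>m. (-1) ^ m * q ^ (m choose 2) * (\<Prod>i<m. a - c * q ^ i)
      * qpoch (c * q ^ m) q (Suc N - m))"
  define R where "R = (\<lambda>m. qbinom q N m * (-1) ^ m * q ^ (m choose 2)
      * (\<Prod>i<m. a * q - c * q * q ^ i) * qpoch (c * q * q ^ m) q (N - m))"
  have step: "qbinom q N m * (q ^ m * T m + T (Suc m)) = (1 - a) * R m" if "m \<le> N" for m
  proof -
    have "(\<Prod>i<m. a * q - c * q * q ^ i) = (\<Prod>i<m. q * (a - c * q ^ i))"
      by (simp add: algebra_simps)
    also have "\<dots> = q ^ m * (\<Prod>i<m. a - c * q ^ i)"
      by (simp add: prod.distrib)
    finally have P: "(\<Prod>i<m. a * q - c * q * q ^ i) = q ^ m * (\<Prod>i<m. a - c * q ^ i)" .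
    have E: "qpoch (c * q ^ m) q (Suc N - m) = (1 - c * q ^ m) * qpoch (c * q * q ^ m) q (N - m)"
      using that by (simp add: Suc_diff_le qpoch_Suc_left mult_ac)
    show ?thesis
      unfolding T_def R_def P choose_two_Suc E
      by (simp add: power_add algebra_simps)
  qed
  have "(\<Sum>m\<le>Suc N. qbinom q (Suc N) m * T m) =
      (\<Sum>m\<le>Suc N. q ^ m * qbinom q N m * T m) + (\<Sum>m\<le>N. qbinom q N m * T (Suc m))"
    by (subst (1 2) sum.atMost_Suc_shift) (simp add: sum.distrib algebra_simps)
  also have "\<dots> = (\<Sum>m\<le>N. qbinom q N m * (q ^ m * T m + T (Suc m)))"
    by (simp add: qbinom_eq_0 sum.distrib algebra_simps)
  also have "\<dots> = (1 - a) * (\<Sum>m\<le>N. R m)"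
    by (simp add: step sum_distrib_left)
  also have "(\<Sum>m\<le>N. R m) = qpoch (a * q) q N"
    unfolding R_def by (rule Suc.IH)
  finally show ?case
    by (simp add: T_def qpoch_Suc_left mult_ac)
qed (simp add: binomial_eq_0)

text \<open>
  Reversal of the product: \<open>1 - q\<^sup>j\<^sup>-\<^sup>n = - q\<^sup>j\<^sup>-\<^sup>n (1 - q\<^sup>n\<^sup>-\<^sup>j)\<close>. This turns the upper parameter
  \<open>q\<^sup>-\<^sup>n\<close> of a terminating series into a Gaussian binomial.
\<close>

lemma qpoch_inverse_power:
  assumes "q \<noteq> 0" "j \<le> n"
  shows "qpoch (inverse (q ^ n)) q j * q ^ (n * j) * qpoch q q (n - j)
         = (-1) ^ j * q ^ (j choose 2) * qpoch q q n"
  using assms(2)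
proof (induction j)
  case (Suc j)
  then obtain d where d: "n = Suc (j + d)" using less_imp_Suc_add[of j n] by auto
  have IH: "qpoch (inverse (q ^ n)) q j * q ^ (n * j) * qpoch q q (Suc d)
         = (-1) ^ j * q ^ (j choose 2) * qpoch q q n"
    using Suc d by simp
  have fac: "(1 - inverse (q ^ n) * q ^ j) * q ^ n = - (q ^ j) * (1 - q ^ Suc d)"
    using assms(1) by (simp add: d field_simps power_add)
  have "qpoch (inverse (q ^ n)) q (Suc j) * q ^ (n * Suc j) * qpoch q q (n - Suc j)
      = qpoch (inverse (q ^ n)) q j * q ^ (n * j) * qpoch q q d *
        ((1 - inverse (q ^ n) * q ^ j) * q ^ n)"
    by (simp add: qpoch_Suc d power_add mult_ac)
  also have "\<dots> = - (q ^ j) * (qpoch (inverse (q ^ n)) q j * q ^ (n * j) * qpoch q q (Suc d))"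
    unfolding fac by (simp add: qpoch_Suc mult_ac)
  finally show ?case
    unfolding IH choose_two_Suc by (simp add: power_add mult_ac)
qed (simp add: binomial_eq_0)

lemma qpoch_inverse_power_eq_0:
  assumes "q \<noteq> 0" "n < j"
  shows "qpoch (inverse (q ^ n)) q j = 0"
  using assms by (auto simp: qpoch_def intro!: bexI[of _ n])

section \<open>Infinite q-shifted factorials and Euler's expansion\<close>

lemma convergent_prod_qpoch:
  fixes a q :: "'a :: {real_normed_field,banach}"
  assumes "norm q < 1"
  shows "convergent_prod (\<lambda>j. 1 - a * q ^ j)"
proof (rule abs_convergent_prod_imp_convergent_prod)
  have "summable (\<lambda>j. norm a * norm q ^ j)"
    using assms by (intro summable_mult summable_geometric) auto
  then show "abs_convergent_prod (\<lambda>j. 1 - a * q ^ j)"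
    by (simp add: abs_convergent_prod_conv_summable norm_mult norm_power)
qed

lemma qpoch_tendsto:
  assumes "norm q < 1"
  shows "qpoch a q \<longlonglongrightarrow> qpoch_inf a q"
  using has_prod_imp_tendsto'[OF convergent_prod_has_prod[OF convergent_prod_qpoch[OF assms]]]
  by (simp add: qpoch_def[abs_def] qpoch_inf_def)

lemma qpoch_inf_split:
  assumes "norm q < 1"
  shows "qpoch_inf a q = qpoch a q n * qpoch_inf (a * q ^ n) q"
proof (rule LIMSEQ_unique)
  show "(\<lambda>m. qpoch a q (n + m)) \<longlonglongrightarrow> qpoch_inf a q"
    using LIMSEQ_ignore_initial_segment[OF qpoch_tendsto[OF assms]] by (subst add.commute)
  show "(\<lambda>m. qpoch a q (n + m)) \<longlonglongrightarrow> qpoch a q n * qpoch_inf (a * q ^ n) q"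
    unfolding qpoch_add by (intro tendsto_intros qpoch_tendsto assms)
qed

lemma norm_mult_power_less_one:
  fixes a q :: complex
  assumes "norm q < 1" "norm a < 1"
  shows "norm (a * q ^ j) < 1"
proof -
  have "norm a * norm q ^ j \<le> norm a * 1"
    using assms by (intro mult_left_mono power_le_one) auto
  then show ?thesis using assms by (simp add: norm_mult norm_power)
qed

lemma qpoch_nonzero:
  assumes "norm q < 1" "norm a < 1"
  shows "qpoch a q n \<noteq> 0"
  using norm_mult_power_less_one[OF assms] by (auto simp: qpoch_def) (metis norm_one less_irrefl)

lemma qpoch_inf_nonzero:
  assumes "norm q < 1" "norm a < 1"
  shows "qpoch_inf a q \<noteq> 0"
  unfolding qpoch_inf_def using norm_mult_power_less_one[OF assms]
  by (intro prodinf_nonzero convergent_prod_qpoch assms) (metis norm_one less_irrefl right_minus_eq)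

lemma norm_one_minus_ge:
  fixes a q :: complex
  assumes "norm q < 1"
  shows "1 - norm a \<le> norm (1 - a * q ^ j)"
proof -
  have "norm a * norm q ^ j \<le> norm a * 1"
    using assms by (intro mult_left_mono power_le_one) auto
  then show ?thesis
    using norm_triangle_ineq2[of 1 "a * q ^ j"] by (simp add: norm_mult norm_power)
qed

lemma norm_qpoch_ge:
  assumes "norm q < 1" "norm a \<le> 1"
  shows "(1 - norm a) ^ n \<le> norm (qpoch a q n)"
proof -
  have "(\<Prod>j<n. 1 - norm a) \<le> (\<Prod>j<n. norm (1 - a * q ^ j))"
    using assms by (intro prod_mono) (auto intro: norm_one_minus_ge)
  then show ?thesis by (simp add: qpoch_def prod_norm)
qed

text \<open>
  The majorants of the series below have ratios of consecutive terms that decay like a power of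
  \<open>q\<^sup>k\<close>. The test is phrased without quotients, so that terms may vanish.
\<close>

lemma summable_ratio_tendsto_0:
  fixes f :: "nat \<Rightarrow> 'a :: banach"
  assumes "\<And>n. norm (f (Suc n)) \<le> r n * norm (f n)" "r \<longlonglongrightarrow> 0"
  shows "summable f"
proof -
  have "eventually (\<lambda>n. r n < 1/2) sequentially"
    using assms(2) by (rule order_tendstoD) simp
  then obtain N where N: "\<And>n. n \<ge> N \<Longrightarrow> r n < 1/2"
    by (auto simp: eventually_sequentially)
  show ?thesis
  proof (rule summable_ratio_test[of "1/2" N])
    fix n assume "n \<ge> N"
    have "r n * norm (f n) \<le> 1/2 * norm (f n)"
      using N[OF \<open>n \<ge> N\<close>] by (intro mult_right_mono) auto
    with assms(1)[of n] show "norm (f (Suc n)) \<le> 1/2 * norm (f n)" by linarith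
  qed simp
qed

lemma summable_power_choose_two:
  fixes q K :: real
  assumes "0 < q" "q < 1"
  shows "summable (\<lambda>m. q ^ (m choose 2) * K ^ m)"
proof (rule summable_ratio_tendsto_0[where r = "\<lambda>m. q ^ m * \<bar>K\<bar>"])
  show "(\<lambda>m. q ^ m * \<bar>K\<bar>) \<longlonglongrightarrow> 0"
    using assms by (intro tendsto_mult_left_zero LIMSEQ_realpow_zero) auto
qed (use assms in \<open>simp add: choose_two_Suc power_add abs_mult mult_ac\<close>)

context
  fixes q :: real
  assumes q: "0 < q" "q < 1"
begin

lemma norm_q: "norm (complex_of_real q) < 1"
  using q by simp

lemma qpoch_q_nonzero: "qpoch (of_real q) (of_real q) n \<noteq> 0"
  by (intro qpoch_nonzero norm_q)

lemma norm_qpoch_q_ge: "(1 - q) ^ n \<le> norm (qpoch (of_real q) (of_real q) n)"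
  using norm_qpoch_ge[of "of_real q" "of_real q" n] q by simp

lemma qbinom_tendsto:
  "(\<lambda>N. qbinom (of_real q) N m) \<longlonglongrightarrow> 1 / qpoch (of_real q) (of_real q) m"
proof -
  let ?q = "complex_of_real q"
  have "(\<lambda>N. qpoch ?q ?q (N + m) / (qpoch ?q ?q m * qpoch ?q ?q N))
      \<longlonglongrightarrow> qpoch_inf ?q ?q / (qpoch ?q ?q m * qpoch_inf ?q ?q)"
    by (intro tendsto_intros LIMSEQ_ignore_initial_segment qpoch_tendsto norm_q)
       (simp add: qpoch_q_nonzero qpoch_inf_nonzero norm_q del: norm_of_real)
  moreover have "qpoch ?q ?q (N + m) / (qpoch ?q ?q m * qpoch ?q ?q N) = qbinom ?q (N + m) m" for N
    using qbinom_mult_qpoch[of m "N + m" ?q]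
    by (simp add: qpoch_q_nonzero field_simps)
  ultimately have "(\<lambda>N. qbinom ?q (N + m) m) \<longlonglongrightarrow> 1 / qpoch ?q ?q m"
    by (simp add: qpoch_inf_nonzero norm_q del: norm_of_real)
  then show ?thesis by (rule LIMSEQ_offset)
qed

text \<open>
  The bound does not depend on \<open>N\<close>: with \<open>q\<close> between 0 and 1, the quotient
  \<open>(q; q)\<^sub>N / (q; q)\<^sub>N\<^sub>-\<^sub>m\<close> is a product of numbers between 0 and 1. It supplies the dominating
  series in Euler's expansion.
\<close>

lemma norm_qbinom_le: "norm (qbinom (of_real q) N m) \<le> 1 / (1 - q) ^ m"
proof (cases "m \<le> N")
  case True
  let ?q = "complex_of_real q"
  have "norm (1 - ?q * ?q ^ j) \<le> 1" for j
  proof -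
    have "1 - ?q * ?q ^ j = of_real (1 - q ^ Suc j)" by simp
    moreover have "q ^ Suc j \<le> 1" using q by (intro power_le_one) auto
    ultimately show ?thesis using q by (simp only: norm_of_real) simp
  qed
  then have le1: "norm (qpoch (?q * ?q ^ (N - m)) ?q m) \<le> 1"
    unfolding qpoch_def prod_norm[symmetric]
    by (intro prod_le_1) (auto simp: mult.assoc simp flip: power_add)
  have "qbinom ?q N m * qpoch ?q ?q m * qpoch ?q ?q (N - m)
      = qpoch (?q * ?q ^ (N - m)) ?q m * qpoch ?q ?q (N - m)"
    using qbinom_mult_qpoch[OF True, of ?q] qpoch_add[of ?q ?q "N - m" m] True
    by (simp add: mult_ac)
  then have "qbinom ?q N m * qpoch ?q ?q m = qpoch (?q * ?q ^ (N - m)) ?q m"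
    using qpoch_q_nonzero by simp
  then have "norm (qbinom ?q N m) * norm (qpoch ?q ?q m) \<le> 1"
    using le1 by (simp flip: norm_mult)
  then have "norm (qbinom ?q N m) * (1 - q) ^ m \<le> 1"
    using norm_qpoch_q_ge[of m] by (smt (verit) mult_left_mono norm_ge_zero)
  then show ?thesis using q by (simp add: field_simps)
qed (use q in \<open>simp add: qbinom_eq_0\<close>)

text \<open>
  Euler's expansion of the infinite product is the limit \<open>N \<rightarrow> \<infinity>\<close> of the finite
  \<open>q\<close>-binomial theorem; Tannery's theorem moves the limit inside the sum.
\<close>

theorem euler_qpoch_inf_sums:
  "(\<lambda>j. (-1) ^ j * of_real q ^ (j choose 2) * z ^ j / qpoch (of_real q) (of_real q) j)
     sums qpoch_inf z (of_real q)"
proof -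
  let ?q = "complex_of_real q"
  define a where "a = (\<lambda>k N. qbinom ?q N k * (-1) ^ k * ?q ^ (k choose 2) * z ^ k)"
  define b where "b = (\<lambda>k. (-1) ^ k * ?q ^ (k choose 2) * z ^ k / qpoch ?q ?q k)"
  define M where "M = (\<lambda>k. q ^ (k choose 2) * (norm z / (1 - q)) ^ k)"
  have lim: "a k \<longlonglongrightarrow> b k" for k
  proof -
    have "a k \<longlonglongrightarrow> 1 / qpoch ?q ?q k * (-1) ^ k * ?q ^ (k choose 2) * z ^ k"
      unfolding a_def by (intro tendsto_intros qbinom_tendsto)
    then show ?thesis by (simp add: b_def mult_ac)
  qed
  have bd: "norm (a k N) \<le> M k" for k N
  proof -
    have "norm (a k N) = norm (qbinom ?q N k) * (q ^ (k choose 2) * norm z ^ k)"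
      using q by (simp add: a_def norm_mult norm_power)
    also have "\<dots> \<le> (1 / (1 - q) ^ k) * (q ^ (k choose 2) * norm z ^ k)"
      using q by (intro mult_right_mono norm_qbinom_le) auto
    finally show ?thesis by (simp add: M_def power_divide)
  qed
  have sM: "summable M" unfolding M_def by (rule summable_power_choose_two[OF q])
  have "eventually (\<lambda>(k, n). norm (a k n) \<le> M k) (sequentially \<times>\<^sub>F sequentially)"
    by (rule always_eventually) (auto simp: bd)
  then have T: "summable (\<lambda>n. norm (b n)) \<and> (\<lambda>N. \<Sum>k. a k N) \<longlonglongrightarrow> suminf b"
    using tannerys_theorem[of a b sequentially M, OF lim _ sM] by auto
  have "(\<Sum>k. a k N) = qpoch z ?q N" for N
  proof -
    have "(\<Sum>k. a k N) = (\<Sum>k\<le>N. a k N)"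
      by (rule suminf_finite) (auto simp: a_def qbinom_eq_0)
    also have "\<dots> = qpoch z ?q N"
      \<comment> \<open>With \<open>c = 0\<close> the inner product is \<open>z\<^sup>m\<close>.\<close>
      using q_chu_vandermonde[of ?q N z 0] by (simp add: a_def qpoch_def)
    finally show ?thesis .
  qed
  with T have "qpoch z ?q \<longlonglongrightarrow> suminf b" by simp
  then have "suminf b = qpoch_inf z ?q"
    using qpoch_tendsto[OF norm_q] LIMSEQ_unique by blast
  with T show ?thesis
    unfolding b_def[symmetric] by (auto simp: sums_iff intro: summable_norm_cancel)
qed

end

section \<open>A transformation of the confluent series\<close>

text \<open>
  A product of summable majorants makes the double series absolutely convergent, so that rows and
  diagonals are two ways of summing the same family.
\<close>

lemma sums_rows_diagonals:
  fixes F :: "nat \<Rightarrow> nat \<Rightarrow> complex"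
  assumes bound: "\<And>m j. norm (F m j) \<le> P m * Q j"
    and P: "summable P" and Q: "summable Q"
    and P0: "\<And>m. P m \<ge> 0" and Q0: "\<And>m. Q m \<ge> 0"
  obtains S where "(\<lambda>m. \<Sum>j. F m j) sums S" and "(\<lambda>N. \<Sum>m\<le>N. F m (N - m)) sums S"
proof -
  have hP: "(P has_sum suminf P) UNIV"
    using P P0 by (intro norm_summable_imp_has_sum summable_sums) auto
  have hQ: "(Q has_sum suminf Q) UNIV"
    using Q Q0 by (intro norm_summable_imp_has_sum summable_sums) auto
  have "(\<lambda>(m, j). P m * Q j) summable_on UNIV \<times> UNIV"
  proof (rule summable_on_SigmaI)
    show "((\<lambda>j. case (m, j) of (m, j) \<Rightarrow> P m * Q j) has_sum P m * suminf Q) UNIV" for m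
      using has_sum_cmult_right[OF hQ] by simp
    show "(\<lambda>m. P m * suminf Q) summable_on UNIV"
      using has_sum_cmult_left[OF hP] by (auto simp: summable_on_def)
  qed (use P0 Q0 in auto)
  then have "(\<lambda>x. norm (case x of (m, j) \<Rightarrow> F m j)) summable_on UNIV \<times> UNIV"
    by (rule Infinite_Sum.abs_summable_on_comparison_test') (use bound in auto)
  then have "(\<lambda>(m, j). F m j) summable_on UNIV \<times> UNIV"
    by (rule abs_summable_summable)
  then obtain S where S: "((\<lambda>(m, j). F m j) has_sum S) (UNIV \<times> UNIV)"
    by (auto simp: summable_on_def)
  show ?thesis
  proof
    have "((\<lambda>m. \<Sum>j. F m j) has_sum S) UNIV"
    proof (rule has_sum_Sigma'[OF S])
      fix m
      have "summable (\<lambda>j. norm (F m j))"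
        by (rule summable_comparison_test'[OF summable_mult[OF Q, of "P m"], of 0]) (use bound in auto)
      then show "((\<lambda>j. case (m, j) of (m, j) \<Rightarrow> F m j) has_sum (\<Sum>j. F m j)) UNIV"
        by (auto intro!: norm_summable_imp_has_sum summable_sums summable_norm_cancel)
    qed
    then show "(\<lambda>m. \<Sum>j. F m j) sums S" by (rule has_sum_imp_sums)
    have "((\<lambda>(N, m). F m (N - m)) has_sum S) (SIGMA N:UNIV. {..N}) \<longleftrightarrow>
          ((\<lambda>(m, j). F m j) has_sum S) (UNIV \<times> UNIV)"
      by (rule has_sum_reindex_bij_witness[where i = "\<lambda>(m, j). (m + j, m)"
            and j = "\<lambda>(N, m). (m, N - m)"]) auto
    with S have "((\<lambda>(N, m). F m (N - m)) has_sum S) (SIGMA N:UNIV. {..N})" by simp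
    then have "((\<lambda>N. \<Sum>m\<le>N. F m (N - m)) has_sum S) UNIV"
      by (rule has_sum_Sigma') (auto intro: has_sum_finite)
    then show "(\<lambda>N. \<Sum>m\<le>N. F m (N - m)) sums S" by (rule has_sum_imp_sums)
  qed
qed

lemma choose_two_add: "((m + j) choose 2) = (m choose 2) + (j choose 2) + m * j"
  by (induction j) (simp_all add: choose_two_Suc binomial_eq_0)

text \<open>
  The transformation
  \<open>\<^sub>1\<phi>\<^sub>1(A; C; q, z) = (z; q)\<^sub>\<infinity> \<Sum>\<^sub>m q\<^sup>m\<^sup>(\<^sup>m\<^sup>-\<^sup>1\<^sup>) (C/A; q)\<^sub>m (A z)\<^sup>m / ((q; q)\<^sub>m (C; q)\<^sub>m (z; q)\<^sub>m)\<close>,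
  a limit case of Jackson's transformation of \<open>\<^sub>2\<phi>\<^sub>1\<close> into \<open>\<^sub>2\<phi>\<^sub>2\<close>. The factor \<open>(z; q)\<^sub>\<infinity> / (z; q)\<^sub>m\<close>
  is written as \<open>(z q\<^sup>m; q)\<^sub>\<infinity>\<close>, and \<open>A\<^sup>m (C/A; q)\<^sub>m\<close> as a product without division.
  Expanding \<open>(z q\<^sup>m; q)\<^sub>\<infinity>\<close> by Euler gives an absolutely convergent double series; its
  diagonal \<open>m + j = N\<close> is a \<open>q\<close>-Chu-Vandermonde sum, because
  \<open>(m choose 2) + (j choose 2) + m j = (N choose 2)\<close>.
\<close>

theorem one_phi_one_transformation:
  fixes q :: real and A C z :: complex
  assumes q: "0 < q" "q < 1" and C: "norm C < 1"
  obtains S where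
    "(\<lambda>N. (-1) ^ N * of_real q ^ (N choose 2) * qpoch A (of_real q) N * z ^ N
        / (qpoch (of_real q) (of_real q) N * qpoch C (of_real q) N)) sums S"
    "(\<lambda>m. (of_real q ^ (m choose 2))\<^sup>2 * (\<Prod>i<m. A - C * of_real q ^ i) * z ^ m
        * qpoch_inf (z * of_real q ^ m) (of_real q)
        / (qpoch (of_real q) (of_real q) m * qpoch C (of_real q) m)) sums S"
proof -
  let ?q = "complex_of_real q"
  note nq = norm_q[OF q] and q0 = qpoch_q_nonzero[OF q]
  have C0: "qpoch C ?q m \<noteq> 0" for m
    by (intro qpoch_nonzero nq C)
  define U where "U = (\<lambda>m. (?q ^ (m choose 2))\<^sup>2 * (\<Prod>i<m. A - C * ?q ^ i) * z ^ m
      / (qpoch ?q ?q m * qpoch C ?q m))"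
  define V where "V = (\<lambda>m j. (-1) ^ j * ?q ^ (j choose 2) * (z * ?q ^ m) ^ j / qpoch ?q ?q j)"
  \<comment> \<open>Summable majorants of \<open>U\<close> and \<open>V\<close>; one of the two factors
    \<open>q ^ (m choose 2)\<close> in \<open>U\<close> is enough, and \<open>V\<close> is bounded uniformly in \<open>m\<close> since \<open>q\<^sup>m \<le> 1\<close>.\<close>
  define P where "P = (\<lambda>m. q ^ (m choose 2)
      * ((norm A + norm C) * norm z / ((1 - q) * (1 - norm C))) ^ m)"
  define Q where "Q = (\<lambda>j. q ^ (j choose 2) * (norm z / (1 - q)) ^ j)"
  have U_le: "norm (U m) \<le> P m" for m
  proof -
    have qm: "norm (?q ^ i) \<le> 1" for i
      using q by (simp add: norm_power power_le_one)
    have "norm (A - C * ?q ^ i) \<le> norm A + norm C" for i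
    proof -
      have "norm (A - C * ?q ^ i) \<le> norm A + norm C * norm (?q ^ i)"
        using norm_triangle_ineq4[of A "C * ?q ^ i"] by (simp add: norm_mult)
      also have "\<dots> \<le> norm A + norm C * 1"
        by (intro add_left_mono mult_left_mono qm) auto
      finally show ?thesis by simp
    qed
    then have "(\<Prod>i<m. norm (A - C * ?q ^ i)) \<le> (\<Prod>i<m. norm A + norm C)"
      by (intro prod_mono) auto
    then have 1: "norm (\<Prod>i<m. A - C * ?q ^ i) \<le> (norm A + norm C) ^ m"
      by (simp add: prod_norm)
    have 2: "norm ((?q ^ (m choose 2))\<^sup>2) \<le> q ^ (m choose 2)"
    proof -
      have "q ^ (m choose 2) * q ^ (m choose 2) \<le> q ^ (m choose 2) * 1"
        using q by (intro mult_left_mono power_le_one) auto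
      then show ?thesis using q by (simp add: norm_power norm_mult power2_eq_square)
    qed
    have 3: "(1 - q) ^ m * (1 - norm C) ^ m \<le> norm (qpoch ?q ?q m * qpoch C ?q m)"
      unfolding norm_mult using C q
      by (intro mult_mono norm_qpoch_q_ge norm_qpoch_ge nq) auto
    have "norm (U m) \<le> q ^ (m choose 2) * (norm A + norm C) ^ m * norm z ^ m
        / ((1 - q) ^ m * (1 - norm C) ^ m)"
      unfolding U_def norm_divide norm_mult[of _ "z ^ m"] norm_power[of z]
        norm_mult[of "_\<^sup>2"] using q C
      by (intro frac_le mult_right_mono mult_mono 1 2 3) auto
    also have "\<dots> = P m"
      by (simp add: P_def power_divide power_mult_distrib)
    finally show ?thesis .
  qed
  have V_le: "norm (V m j) \<le> Q j" for m j
  proof -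
    have "norm (z * ?q ^ m) ^ j \<le> norm z ^ j"
      using q by (intro power_mono) (auto simp: norm_mult norm_power intro!: mult_right_le_one_le power_le_one)
    then have "norm (V m j) \<le> q ^ (j choose 2) * norm z ^ j / (1 - q) ^ j"
      unfolding V_def norm_divide norm_mult norm_power using q
      by (intro frac_le mult_mono norm_qpoch_q_ge)
         (auto simp: norm_mult norm_power)
    then show ?thesis by (simp add: Q_def power_divide)
  qed
  have P0: "P m \<ge> 0" and Q0: "Q m \<ge> 0" for m
    using q C by (auto simp: P_def Q_def)
  obtain S where S: "(\<lambda>m. \<Sum>j. U m * V m j) sums S" "(\<lambda>N. \<Sum>m\<le>N. U m * V m (N - m)) sums S"
  proof (rule sums_rows_diagonals)
    show "norm (U m * V m j) \<le> P m * Q j" for m j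
      unfolding norm_mult by (intro mult_mono U_le V_le P0) auto
    show "summable P" "summable Q"
      unfolding P_def Q_def by (intro summable_power_choose_two q)+
  qed (auto intro: P0 Q0)
  show ?thesis
  proof
    have "(\<Sum>j. U m * V m j) = U m * qpoch_inf (z * ?q ^ m) ?q" for m
    proof -
      have "V m sums qpoch_inf (z * ?q ^ m) ?q"
        unfolding V_def by (rule euler_qpoch_inf_sums[OF q])
      from sums_mult[OF this, of "U m"] show ?thesis by (simp add: sums_iff)
    qed
    with S(1) show "(\<lambda>m. (?q ^ (m choose 2))\<^sup>2 * (\<Prod>i<m. A - C * ?q ^ i) * z ^ m
        * qpoch_inf (z * ?q ^ m) ?q / (qpoch ?q ?q m * qpoch C ?q m)) sums S"
      by (simp add: U_def)
    have "(\<Sum>m\<le>N. U m * V m (N - m)) = (-1) ^ N * ?q ^ (N choose 2) * qpoch A ?q N * z ^ N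
        / (qpoch ?q ?q N * qpoch C ?q N)" for N
    proof -
      have "U m * V m (N - m) = (-1) ^ N * ?q ^ (N choose 2) * z ^ N / (qpoch ?q ?q N * qpoch C ?q N)
         * (qbinom ?q N m * (-1) ^ m * ?q ^ (m choose 2)
         * (\<Prod>i<m. A - C * ?q ^ i) * qpoch (C * ?q ^ m) ?q (N - m))" if mN: "m \<le> N" for m
      proof -
        obtain d where d: "N = m + d" using le_Suc_ex[OF mN] by blast
        have b: "qbinom ?q N m = qpoch ?q ?q N / (qpoch ?q ?q m * qpoch ?q ?q d)"
          using qbinom_mult_qpoch[OF mN, of ?q] q0[of m] q0[of d]
          by (simp add: d eq_divide_eq mult.assoc)
        have c: "qpoch C ?q N = qpoch C ?q m * qpoch (C * ?q ^ m) ?q d"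
          by (simp add: d qpoch_add)
        have c0: "qpoch (C * ?q ^ m) ?q d \<noteq> 0"
          using C0[of N] by (simp add: c)
        have sgn: "(-1 :: complex) ^ N * (-1) ^ m = (-1) ^ d"
          by (auto simp: d minus_one_power_iff)
        have "(-1) ^ N * ?q ^ (N choose 2) * z ^ N / (qpoch ?q ?q N * qpoch C ?q N)
         * (qbinom ?q N m * (-1) ^ m * ?q ^ (m choose 2)
         * (\<Prod>i<m. A - C * ?q ^ i) * qpoch (C * ?q ^ m) ?q (N - m))
          = ((-1) ^ N * (-1) ^ m) * (?q ^ (N choose 2) * ?q ^ (m choose 2)) * z ^ N
            * (\<Prod>i<m. A - C * ?q ^ i) / (qpoch ?q ?q m * qpoch ?q ?q d * qpoch C ?q m)"
        proof -
          have "N - m = d" by (simp add: d)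
          then show ?thesis
            unfolding b c using q0[of N] q0[of m] q0[of d] C0[of m] c0 by (simp add: divide_simps)
        qed
        also have "\<dots> = U m * V m (N - m)"
        proof -
          have 1: "?q ^ (N choose 2) = ?q ^ (m choose 2) * ?q ^ (d choose 2) * ?q ^ (m * d)"
            by (simp only: d choose_two_add power_add)
          have 2: "(z * ?q ^ m) ^ d = z ^ d * ?q ^ (m * d)"
            by (simp only: power_mult_distrib power_mult)
          have 3: "z ^ N = z ^ m * z ^ d" by (simp only: d power_add)
          have 4: "N - m = d" by (simp add: d)
          show ?thesis
            unfolding sgn U_def V_def 4 1 2 3 by (simp add: power2_eq_square mult_ac)
        qed
        finally show ?thesis ..
      qed
      then have "(\<Sum>m\<le>N. U m * V m (N - m)) =
         (-1) ^ N * ?q ^ (N choose 2) * z ^ N / (qpoch ?q ?q N * qpoch C ?q N) * qpoch A ?q N"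
        unfolding q_chu_vandermonde[of ?q N A C, symmetric] by (simp add: sum_distrib_left)
      then show ?thesis by simp
    qed
    with S(2) show "(\<lambda>N. (-1) ^ N * ?q ^ (N choose 2) * qpoch A ?q N * z ^ N
        / (qpoch ?q ?q N * qpoch C ?q N)) sums S" by simp
  qed
qed

section \<open>The integral over the finite products\<close>

text \<open>
  The integrand of the Mellin transform at \<open>s\<close> of \<open>1 / (-x; q)\<^sub>N\<close>. The indicator of the half-line
  is part of it, so that the scaling \<open>x \<mapsto> q x\<close> maps integrals over the whole line to each other.
\<close>

definition mellin_kernel :: "real \<Rightarrow> real \<Rightarrow> nat \<Rightarrow> real \<Rightarrow> real" where
  "mellin_kernel q s N x = indicator {0<..} x * x powr (s - 1) / (\<Prod>j<N. 1 + x * q ^ j)"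

lemma prod_one_plus_pos: "0 < q \<Longrightarrow> 0 \<le> x \<Longrightarrow> (\<Prod>j<N. 1 + x * q ^ j) > (0::real)"
  by (intro prod_pos ballI add_pos_nonneg mult_nonneg_nonneg) auto

text \<open>
  Dilation by \<open>q\<close> shifts the product: with \<open>h\<^sub>N x = 1 / (-x; q)\<^sub>N\<close> one has
  \<open>(1 + x q\<^sup>N) h\<^sub>N\<^sub>+\<^sub>1 x = h\<^sub>N x\<close> and \<open>(1 + x) h\<^sub>N\<^sub>+\<^sub>1 x = h\<^sub>N (q x)\<close>, whence
  \<open>(1 - q\<^sup>N) h\<^sub>N\<^sub>+\<^sub>1 x = h\<^sub>N x - q\<^sup>N h\<^sub>N (q x)\<close>. Integration against \<open>x\<^sup>s\<^sup>-\<^sup>1\<close> makes this a first-order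
  recurrence for the Mellin transforms, and also transports integrability from \<open>N\<close> to \<open>N + 1\<close>.
\<close>

lemma mellin_kernel_step:
  assumes q: "0 < q" "q < 1" and N: "N > 0"
    and I: "has_bochner_integral lborel (mellin_kernel q s N) I"
  shows "has_bochner_integral lborel (mellin_kernel q s (Suc N))
           ((1 - q powr (real N - s)) / (1 - q ^ N) * I)"
proof -
  have qN: "q ^ N < 1" using q N by (simp add: power_less_one_iff)
  have pq: "q ^ N * q powr (1 - s) = q * q powr (real N - s)"
    using q by (simp add: powr_realpow[symmetric] powr_add[symmetric] powr_mult_base algebra_simps)
  have *: "has_bochner_integral lborel (\<lambda>x. mellin_kernel q s N (0 + q * x)) (I /\<^sub>R \<bar>q\<bar>)"
    by (subst lborel_has_bochner_integral_real_affine_iff[symmetric]) (use q I in auto)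
  have "has_bochner_integral lborel
      (\<lambda>x. (mellin_kernel q s N x - (q ^ N * q powr (1 - s)) * mellin_kernel q s N (0 + q * x)) / (1 - q ^ N))
      ((I - (q ^ N * q powr (1 - s)) * (I /\<^sub>R \<bar>q\<bar>)) / (1 - q ^ N))"
    by (intro has_bochner_integral_divide_zero has_bochner_integral_diff
        has_bochner_integral_mult_right I *)
  moreover have "(mellin_kernel q s N x - (q ^ N * q powr (1 - s)) * mellin_kernel q s N (0 + q * x)) / (1 - q ^ N)
      = mellin_kernel q s (Suc N) x" for x
  proof (cases "x > 0")
    case True
    define D where "D = (\<Prod>j<N. 1 + x * q ^ j)"
    define E where "E = (\<Prod>j<N. 1 + q * x * q ^ j)"
    have pos: "D > 0" "E > 0" "1 + x * q ^ N > 0"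
      unfolding D_def E_def using True q by (auto intro!: prod_one_plus_pos add_pos_nonneg)
    have DE: "D * (1 + x * q ^ N) = (1 + x) * E"
    proof -
      have "(\<Prod>j<Suc N. 1 + x * q ^ j) = (1 + x) * E"
        by (subst prod.lessThan_Suc_shift) (simp add: E_def mult_ac)
      then show ?thesis by (simp add: D_def)
    qed
    have px: "q powr (1 - s) * (q * x) powr (s - 1) = x powr (s - 1)"
      using q True by (simp add: powr_mult flip: powr_add mult.assoc)
    have E1: "1 / E = (1 + x) / (D * (1 + x * q ^ N))"
      using pos True unfolding DE by simp
    have D1: "1 / D = (1 + x * q ^ N) / (D * (1 + x * q ^ N))"
      using pos by simp
    have "1 / D - q ^ N * (1 / E) = (1 - q ^ N) / (D * (1 + x * q ^ N))"
      unfolding E1 unfolding D1 by (simp add: algebra_simps flip: diff_divide_distrib)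
    then have "(1 / D - q ^ N * (1 / E)) / (1 - q ^ N) = 1 / (D * (1 + x * q ^ N))"
      using qN by simp
    moreover have "(mellin_kernel q s N x - (q ^ N * q powr (1 - s)) * mellin_kernel q s N (0 + q * x)) / (1 - q ^ N)
       = x powr (s - 1) * ((1 / D - q ^ N * (1 / E)) / (1 - q ^ N))"
    proof -
      have "(q ^ N * q powr (1 - s)) * mellin_kernel q s N (0 + q * x)
          = q ^ N * (q powr (1 - s) * (q * x) powr (s - 1)) / E"
        using True q by (simp add: mellin_kernel_def E_def)
      then show ?thesis
        unfolding px using True by (simp add: mellin_kernel_def D_def algebra_simps)
    qed
    ultimately show ?thesis
      using True by (simp add: mellin_kernel_def D_def)
  next
    case False
    then show ?thesis using q by (simp add: mellin_kernel_def zero_less_mult_iff)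
  qed
  moreover have "(I - (q ^ N * q powr (1 - s)) * (I /\<^sub>R \<bar>q\<bar>)) / (1 - q ^ N)
      = (1 - q powr (real N - s)) / (1 - q ^ N) * I"
    unfolding pq using q by (simp add: field_simps)
  ultimately show ?thesis by (simp only:)
qed

text \<open>
  The start of the recurrence for \<open>0 < s < 1\<close>: the substitution \<open>t = x / (1 + x)\<close> turns the
  Beta integral \<open>B(s, 1 - s)\<close>, evaluated by the reflection formula, into this one.
\<close>

lemma has_bochner_integral_powr_over_one_plus:
  assumes s: "0 < s" "s < 1"
  shows "has_bochner_integral lborel (mellin_kernel q s 1) (pi / sin (pi * s))"
proof -
  define f where "f = (\<lambda>t::real. t powr (s - 1) * (1 - t) powr (1 - s - 1))"
  have "Beta s (1 - s) = pi / sin (pi * s)"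
  proof -
    have "Gamma (complex_of_real s) * Gamma (1 - complex_of_real s) = of_real pi / sin (of_real pi * of_real s)"
      by (rule Gamma_reflection_complex)
    moreover have "1 - complex_of_real s = of_real (1 - s)" by simp
    ultimately have "complex_of_real (Gamma s * Gamma (1 - s)) = of_real (pi / sin (pi * s))"
      by (simp only: Gamma_complex_of_real of_real_mult of_real_divide sin_of_real[symmetric])
    then have "Gamma s * Gamma (1 - s) = pi / sin (pi * s)"
      by (simp only: of_real_eq_iff)
    then show ?thesis by (simp add: Beta_def)
  qed
  then have "(f has_integral pi / sin (pi * s)) {0..1}"
    using has_integral_Beta_real[of s "1 - s"] s by (simp add: f_def)
  then have f01: "(f has_integral pi / sin (pi * s)) {0<..<1}"
    by (simp add: has_integral_Icc_iff_Ioo)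
  then have fabs: "f absolutely_integrable_on {0<..<1}"
    by (intro nonnegative_absolutely_integrable_1) (auto simp: f_def has_integral_integrable)
  define g where "g = (\<lambda>x::real. x / (1 + x))"
  have im: "g ` {0<..} = {0<..<1}"
  proof
    show "{0<..<1} \<subseteq> g ` {0<..}"
    proof
      fix y :: real assume "y \<in> {0<..<1}"
      then have "y = g (y / (1 - y))" "y / (1 - y) \<in> {0<..}" by (auto simp: g_def field_simps)
      then show "y \<in> g ` {0<..}" by blast
    qed
  qed (auto simp: g_def field_simps)
  have inj: "inj_on g {0<..}"
    by (auto simp: inj_on_def g_def field_simps)
  have der: "(g has_field_derivative 1 / (1 + x)\<^sup>2) (at x within {0<..})" if "x \<in> {0<..}" for x
    unfolding g_def using that
    by (auto intro!: derivative_eq_intros simp: field_simps power2_eq_square)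
  have "f absolutely_integrable_on g ` {0<..} \<and> integral (g ` {0<..}) f = pi / sin (pi * s)"
    unfolding im using fabs f01 by (simp add: integral_unique)
  then have "(\<lambda>x. \<bar>1 / (1 + x)\<^sup>2\<bar> * f (g x)) absolutely_integrable_on {0<..} \<and>
      integral {0<..} (\<lambda>x. \<bar>1 / (1 + x)\<^sup>2\<bar> * f (g x)) = pi / sin (pi * s)"
    using has_absolute_integral_change_of_variables_1'[OF _ der inj, of f "pi / sin (pi * s)"] by simp
  moreover have "\<bar>1 / (1 + x)\<^sup>2\<bar> * f (g x) = x powr (s - 1) / (1 + x)" if "x \<in> {0<..}" for x
  proof -
    have x: "x > 0" using that by simp
    have "1 - g x = 1 / (1 + x)" using x by (simp add: g_def field_simps)
    then have "f (g x) = (x powr (s - 1) / (1 + x) powr (s - 1)) * (1 + x) powr s"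
      using x by (simp add: f_def g_def powr_divide powr_minus field_simps)
    also have "(1 + x) powr s = (1 + x) powr (s - 1) * (1 + x)"
      using x powr_add[of "1 + x" "s - 1" 1] by simp
    finally have "f (g x) = x powr (s - 1) * (1 + x)" using x by simp
    then show ?thesis using x by (simp add: power2_eq_square)
  qed
  ultimately have "(\<lambda>x. x powr (s - 1) / (1 + x)) absolutely_integrable_on {0<..} \<and>
      integral {0<..} (\<lambda>x. x powr (s - 1) / (1 + x)) = pi / sin (pi * s)"
    by (metis (no_types, lifting) absolutely_integrable_spike_eq integral_cong
        set_integrable_cong)
  then have A: "set_integrable lebesgue {0<..} (\<lambda>x. x powr (s - 1) / (1 + x))"
     "integral {0<..} (\<lambda>x. x powr (s - 1) / (1 + x)) = pi / sin (pi * s)" by auto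
  have k: "mellin_kernel q s 1 = (\<lambda>x. indicator {0<..} x *\<^sub>R (x powr (s - 1) / (1 + x)))"
    by (simp add: mellin_kernel_def fun_eq_iff)
  have m: "mellin_kernel q s 1 \<in> borel_measurable lborel"
    unfolding mellin_kernel_def by measurable
  have "integrable lebesgue (mellin_kernel q s 1)"
    using A(1) unfolding k set_integrable_def .
  moreover have "integral\<^sup>L lebesgue (mellin_kernel q s 1) = pi / sin (pi * s)"
    using set_lebesgue_integral_eq_integral(2)[OF A(1)] A(2)
    unfolding k set_lebesgue_integral_def by simp
  ultimately show ?thesis
    using m by (simp add: has_bochner_integral_iff integrable_completion integral_completion)
qed

text \<open>
  At \<open>s = 1\<close> the integral with one factor diverges, so the recurrence starts with two factors,
  where \<open>ln ((1 + x) / (1 + x q)) / (1 - q)\<close> is an antiderivative.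
\<close>

lemma has_bochner_integral_one_over_two_factors:
  assumes q: "0 < q" "q < 1"
  shows "has_bochner_integral lborel (mellin_kernel q 1 2) (- ln q / (1 - q))"
proof -
  define f where "f = (\<lambda>x::real. 1 / ((1 + x) * (1 + x * q)))"
  define F where "F = (\<lambda>x::real. (ln (1 + x) - ln (1 + x * q)) / (1 - q))"
  have "(\<integral>\<^sup>+x. ennreal (f x) * indicator {0..} x \<partial>lborel) = (- ln q / (1 - q)) - F 0"
  proof (rule nn_integral_FTC_atLeast)
    show "f \<in> borel_measurable borel" unfolding f_def by measurable
    fix x :: real assume "0 \<le> x"
    then have p: "1 + x > 0" "1 + x * q > 0" using q by (auto intro: add_pos_nonneg)
    show "0 \<le> f x" using p by (simp add: f_def)
    show "DERIV F x :> f x"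
      unfolding F_def f_def using p q
      by (auto intro!: derivative_eq_intros) (simp add: divide_simps; simp add: algebra_simps)
  next
    have "((\<lambda>x. ln ((1 + x) / (1 + x * q)) / (1 - q)) \<longlongrightarrow> - ln q / (1 - q)) at_top"
    proof (rule tendsto_divide)
      have "((\<lambda>x::real. (inverse x + 1) / (inverse x + q)) \<longlongrightarrow> (0 + 1) / (0 + q)) at_top"
        using q by (intro tendsto_intros tendsto_inverse_0_at_top filterlim_ident) auto
      moreover have "eventually (\<lambda>x::real. (inverse x + 1) / (inverse x + q) = (1 + x) / (1 + x * q)) at_top"
        using eventually_gt_at_top[of 0]
      proof eventually_elim
        case (elim x)
        have "inverse x + 1 = (1 + x) / x" "inverse x + q = (1 + x * q) / x"
          using elim by (simp_all add: field_simps)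
        then show ?case using elim by simp
      qed
      ultimately have "((\<lambda>x. (1 + x) / (1 + x * q)) \<longlongrightarrow> 1 / q) at_top"
        by (simp add: filterlim_cong)
      then have "((\<lambda>x. ln ((1 + x) / (1 + x * q))) \<longlongrightarrow> ln (1 / q)) at_top"
        using q by (intro tendsto_ln) auto
      then show "((\<lambda>x. ln ((1 + x) / (1 + x * q))) \<longlongrightarrow> - ln q) at_top"
        using q by (simp add: ln_div)
    qed (use q in auto)
    moreover have "eventually (\<lambda>x. ln ((1 + x) / (1 + x * q)) / (1 - q) = F x) at_top"
      using eventually_ge_at_top[of 0]
    proof eventually_elim
      case (elim x)
      have "1 + x > 0" "1 + x * q > 0" using elim q by (auto intro: add_pos_nonneg)
      then show ?case by (simp add: F_def ln_div)
    qed
    ultimately show "(F \<longlongrightarrow> - ln q / (1 - q)) at_top"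
      by (simp add: filterlim_cong)
  qed
  also have "F 0 = 0" by (simp add: F_def)
  also have "(\<integral>\<^sup>+x. ennreal (f x) * indicator {0..} x \<partial>lborel)
     = (\<integral>\<^sup>+x. ennreal (mellin_kernel q 1 2 x) \<partial>lborel)"
  proof (rule nn_integral_cong_AE)
    have "AE x in lborel. x \<noteq> (0::real)" by (rule AE_lborel_singleton)
    then show "AE x in lborel. ennreal (f x) * indicator {0..} x = ennreal (mellin_kernel q 1 2 x)"
      by eventually_elim
        (auto simp: mellin_kernel_def f_def numeral_2_eq_2 indicator_def)
  qed
  finally have "(\<integral>\<^sup>+x. ennreal (mellin_kernel q 1 2 x) \<partial>lborel) = ennreal (- ln q / (1 - q))"
    by simp
  moreover have "mellin_kernel q 1 2 \<in> borel_measurable lborel"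
    unfolding mellin_kernel_def by measurable
  moreover have "0 \<le> mellin_kernel q 1 2 x" for x
    unfolding mellin_kernel_def using q
    by (cases "x > 0") (auto intro!: divide_nonneg_pos prod_one_plus_pos less_imp_le[OF prod_one_plus_pos])
  moreover have "- ln q / (1 - q) \<ge> 0" using q by (intro divide_nonneg_pos) auto
  ultimately show ?thesis
    by (intro has_bochner_integral_nn_integral) auto
qed

section \<open>Moments of the q-Laguerre weight\<close>

definition mellin_kernel_inf :: "real \<Rightarrow> real \<Rightarrow> real \<Rightarrow> real" where
  "mellin_kernel_inf q s x = indicator {0<..} x * x powr (s - 1) / (\<Prod>j. 1 + x * q ^ j)"

lemma convergent_prod_one_plus:
  fixes q x :: real
  assumes "0 < q" "q < 1"
  shows "convergent_prod (\<lambda>j. 1 + x * q ^ j)"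
  using convergent_prod_qpoch[of q "- x"] assms by simp

lemma prodinf_one_plus_nonzero:
  fixes q x :: real
  assumes "0 < q" "q < 1" "x \<ge> 0"
  shows "(\<Prod>j. 1 + x * q ^ j) \<noteq> 0"
proof (rule prodinf_nonzero[OF convergent_prod_one_plus[OF assms(1,2)]])
  show "1 + x * q ^ j \<noteq> 0" for j
    using assms add_pos_nonneg[of 1 "x * q ^ j"] by simp
qed

lemma mellin_kernel_inf_nonneg:
  assumes q: "0 < q" "q < 1"
  shows "0 \<le> mellin_kernel_inf q s x"
proof (cases "x > 0")
  case True
  have "(\<lambda>N. \<Prod>j<N. 1 + x * q ^ j) \<longlonglongrightarrow> (\<Prod>j. 1 + x * q ^ j)"
    by (intro has_prod_imp_tendsto' convergent_prod_has_prod convergent_prod_one_plus q)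
  then have "0 \<le> (\<Prod>j. 1 + x * q ^ j)"
    using True q prod_one_plus_pos[of q x] by (intro LIMSEQ_le_const) (auto intro: less_imp_le)
  then show ?thesis by (simp add: mellin_kernel_inf_def)
qed (simp add: mellin_kernel_inf_def)

text \<open>
  The kernels decrease in \<open>N\<close>, hence the first integrable one dominates all later ones and
  their limit.
\<close>

lemma has_bochner_integral_mellin_kernel_inf:
  assumes q: "0 < q" "q < 1"
    and I: "\<And>N. has_bochner_integral lborel (mellin_kernel q s (N0 + N)) (I N)"
  obtains L where "has_bochner_integral lborel (mellin_kernel_inf q s) L" "I \<longlonglongrightarrow> L"
proof -
  have meas: "mellin_kernel q s N \<in> borel_measurable lborel" for N
    unfolding mellin_kernel_def by measurable
  have lim: "(\<lambda>N. mellin_kernel q s (N0 + N) x) \<longlonglongrightarrow> mellin_kernel_inf q s x" for x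
  proof (cases "x > 0")
    case True
    have "(\<lambda>N. \<Prod>j<N. 1 + x * q ^ j) \<longlonglongrightarrow> (\<Prod>j. 1 + x * q ^ j)"
      by (intro has_prod_imp_tendsto' convergent_prod_has_prod convergent_prod_one_plus q)
    then have "(\<lambda>N. mellin_kernel q s N x) \<longlonglongrightarrow> mellin_kernel_inf q s x"
      unfolding mellin_kernel_def mellin_kernel_inf_def
      using prodinf_one_plus_nonzero[OF q, of x] True by (intro tendsto_intros) auto
    from LIMSEQ_ignore_initial_segment[OF this, of N0] show ?thesis
      by (simp add: add.commute)
  qed (simp add: mellin_kernel_def mellin_kernel_inf_def)
  have bound: "norm (mellin_kernel q s (N0 + N) x) \<le> mellin_kernel q s (N0 + 0) x" for N x
  proof (cases "x > 0")
    case True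
    have "(\<Prod>j<N0 + N. 1 + x * q ^ j) = (\<Prod>j<N0. 1 + x * q ^ j) * (\<Prod>j<N. 1 + x * q ^ N0 * q ^ j)"
      by (induction N) (simp_all add: power_add mult_ac)
    moreover have "(\<Prod>j<N. 1 + x * q ^ N0 * q ^ j) \<ge> 1"
      using True q by (intro prod_ge_1) auto
    moreover have "(\<Prod>j<N0. 1 + x * q ^ j) > 0"
      using True q by (intro prod_one_plus_pos) auto
    ultimately have "(\<Prod>j<N0. 1 + x * q ^ j) \<le> (\<Prod>j<N0 + N. 1 + x * q ^ j)"
      "(\<Prod>j<N0. 1 + x * q ^ j) > 0" by simp_all
    then show ?thesis
      using True by (simp add: mellin_kernel_def norm_divide frac_le)
  qed (simp add: mellin_kernel_def)
  have meas_inf: "mellin_kernel_inf q s \<in> borel_measurable lborel"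
    by (rule borel_measurable_LIMSEQ_real[OF lim meas])
  have int0: "integrable lborel (mellin_kernel q s (N0 + 0))"
    using I[of 0] by (simp add: has_bochner_integral_iff)
  have "integrable lborel (mellin_kernel_inf q s)"
    using meas_inf meas int0 
    by (rule integrable_dominated_convergence[where s = "\<lambda>N. mellin_kernel q s (N0 + N)"])
      (use lim bound in auto)
  then have 1: "has_bochner_integral lborel (mellin_kernel_inf q s) (integral\<^sup>L lborel (mellin_kernel_inf q s))"
    by (simp add: has_bochner_integral_iff)
  have "(\<lambda>N. integral\<^sup>L lborel (mellin_kernel q s (N0 + N))) \<longlonglongrightarrow> integral\<^sup>L lborel (mellin_kernel_inf q s)"
    using meas_inf meas int0 
    by (rule integral_dominated_convergence[where s = "\<lambda>N. mellin_kernel q s (N0 + N)"])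
      (use lim bound in auto)
  moreover have "integral\<^sup>L lborel (mellin_kernel q s (N0 + N)) = I N" for N
    using I[of N] by (simp add: has_bochner_integral_iff)
  ultimately have "I \<longlonglongrightarrow> integral\<^sup>L lborel (mellin_kernel_inf q s)" by simp
  with 1 show ?thesis by (rule that)
qed

text \<open>
  The weight \<open>w x = 1 / (-x; q)\<^sub>\<infinity>\<close> satisfies \<open>w (q x) = (1 + x) w x\<close>. Therefore \<open>x w x\<close> is
  \<open>w (q x) - w x\<close>: raising the exponent by one costs only a dilation.
\<close>

lemma mellin_kernel_inf_step:
  assumes q: "0 < q" "q < 1"
    and I: "has_bochner_integral lborel (mellin_kernel_inf q s) I"
  shows "has_bochner_integral lborel (mellin_kernel_inf q (s + 1)) ((q powr (- s) - 1) * I)"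
proof -
  have *: "has_bochner_integral lborel (\<lambda>x. mellin_kernel_inf q s (0 + q * x)) (I /\<^sub>R \<bar>q\<bar>)"
    by (subst lborel_has_bochner_integral_real_affine_iff[symmetric]) (use q I in auto)
  have "has_bochner_integral lborel
      (\<lambda>x. q powr (1 - s) * mellin_kernel_inf q s (0 + q * x) - mellin_kernel_inf q s x)
      (q powr (1 - s) * (I /\<^sub>R \<bar>q\<bar>) - I)"
    by (intro has_bochner_integral_diff has_bochner_integral_mult_right I *)
  moreover have "q powr (1 - s) * mellin_kernel_inf q s (0 + q * x) - mellin_kernel_inf q s x
      = mellin_kernel_inf q (s + 1) x" for x
  proof (cases "x > 0")
    case True
    define D where "D = (\<Prod>j. 1 + x * q ^ j)"
    define E where "E = (\<Prod>j. 1 + q * x * q ^ j)"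
    have nz: "D \<noteq> 0" "E \<noteq> 0"
      unfolding D_def E_def
      using True q prodinf_one_plus_nonzero[OF q, of x] prodinf_one_plus_nonzero[OF q, of "q * x"]
      by simp_all
    have DE: "D = (1 + x) * E"
    proof -
      from prodinf_split_initial_segment[of "\<lambda>j. 1 + x * q ^ j" 1]
      have "D = (\<Prod>j. 1 + x * q ^ Suc j) * (1 + x)"
        using True convergent_prod_one_plus[OF q, of x] by (simp add: D_def)
      then show ?thesis by (simp add: E_def mult_ac)
    qed
    have px: "q powr (1 - s) * (q * x) powr (s - 1) = x powr (s - 1)"
      using q True by (simp add: powr_mult flip: powr_add mult.assoc)
    have ps: "x powr s = x powr (s - 1) * x"
      using True powr_add[of x "s - 1" 1] by simp
    have "q powr (1 - s) * mellin_kernel_inf q s (0 + q * x)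
        = (q powr (1 - s) * (q * x) powr (s - 1)) / E"
      using True q by (simp add: mellin_kernel_inf_def E_def)
    also have "\<dots> = x powr (s - 1) * (1 + x) / D"
      unfolding px DE using True by simp
    finally show ?thesis
      using True by (simp add: mellin_kernel_inf_def D_def[symmetric] ps algebra_simps add_divide_distrib)
  next
    case False
    then show ?thesis using q by (simp add: mellin_kernel_inf_def zero_less_mult_iff)
  qed
  moreover have "q powr (1 - s) * (I /\<^sub>R \<bar>q\<bar>) - I = (q powr (- s) - 1) * I"
  proof -
    have "q powr (1 - s) = q * q powr (- s)" using q by (simp add: powr_mult_base)
    then show ?thesis using q by (simp add: algebra_simps)
  qed
  ultimately show ?thesis by (simp only:)
qed

text \<open>
  \<open>- M\<^sub>0\<close> obeys the recurrence of the moments. The two branches of the definition of \<open>M\<^sub>0\<close> need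
  separate verification; \<open>\<beta>\<close> and \<open>\<beta> + 1\<close> lie in the same branch because \<open>\<beta> > -1\<close>.
\<close>

lemma qlag_factor_step:
  assumes q: "0 < q" "q < 1" and \<beta>: "\<beta> > -1"
  shows "qlag_factor q 0 (\<beta> + 1) = of_real (q powr (- (\<beta> + 1)) - 1) * qlag_factor q 0 \<beta>"
proof (cases "\<beta> \<in> \<nat>")
  case True
  then obtain m where m: "\<beta> = real m" by (auto elim: Nats_cases)
  have val: "qlag_factor q 0 (real k)
      = qpoch (of_real q) (of_real q) k * of_real (ln q) / of_real q ^ (Suc k choose 2)" for k
  proof -
    have "real k * (real k + 1) / 2 = real (Suc k choose 2)"
      by (induction k) (simp_all add: choose_two_Suc binomial_eq_0 field_simps)
    then have "q powr (real k * (real k + 1) / 2) = q ^ (Suc k choose 2)"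
      using q by (simp only: powr_realpow)
    then show ?thesis by (simp add: qlag_factor_def)
  qed
  have S: "real m + 1 = real (Suc m)" by simp
  have "q powr (- (real (Suc m))) = inverse (q ^ Suc m)"
    using q by (simp only: powr_minus powr_realpow)
  then have "complex_of_real (q powr (- (real (Suc m))) - 1) = inverse (of_real q ^ Suc m) - 1"
    by simp
  then show ?thesis
    unfolding m S val using q
    by (simp add: qpoch_Suc choose_two_Suc[of "Suc m"] power_add field_simps)
next
  case False
  have F': "\<beta> + 1 \<notin> \<nat>"
  proof
    assume "\<beta> + 1 \<in> \<nat>"
    then obtain k where k: "\<beta> + 1 = real k" by (auto elim: Nats_cases)
    with \<beta> have "k > 0" by (cases k) auto
    with k have "\<beta> = real (k - 1)" by simp
    with False show False by simp
  qed
  have sin: "sin (pi * (\<beta> + 1)) = - sin (pi * \<beta>)"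
    by (simp add: distrib_left sin_add)
  have "q powr (- (\<beta> + 1)) * q = q powr (- \<beta>)"
    using q by (simp add: mult.commute powr_mult_base)
  \<comment> \<open>The first factor of the product at \<open>\<beta> + 1\<close> is split off; the rest is the product at \<open>\<beta>\<close>.\<close>
  then have X: "qpoch_inf (of_real (q powr (- (\<beta> + 1)))) (of_real q)
      = (1 - of_real (q powr (- (\<beta> + 1)))) * qpoch_inf (of_real (q powr (- \<beta>))) (of_real q)"
    using qpoch_inf_split[OF norm_q[OF q], of "of_real (q powr (- (\<beta> + 1)))" 1]
    by (simp add: qpoch_Suc flip: of_real_mult)
  have neg: "of_real (r - 1) = - (1 - complex_of_real r)" for r by simp
  show ?thesis
    unfolding qlag_factor_def sin X neg using False F' by (simp add: minus_divide_left algebra_simps)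
qed

lemma qlag_factor_conv_0:
  assumes q: "0 < q" "q < 1"
  shows "qlag_factor q n \<beta> = qlag_factor q 0 \<beta>
    * qpoch (of_real (q powr (\<beta> + 1))) (of_real q) n / qpoch (of_real q) (of_real q) n"
proof (cases "\<beta> \<in> \<nat>")
  case True
  then obtain m where m: "\<beta> = real m" by (auto elim: Nats_cases)
  let ?q = "complex_of_real q"
  have "q powr (real m + 1) = q * q ^ m"
    using q by (simp add: powr_add powr_realpow mult.commute)
  then have b: "complex_of_real (q powr (real m + 1)) = ?q * ?q ^ m" by simp
  have "qpoch ?q ?q (n + m) = qpoch ?q ?q (m + n)" by (simp add: add.commute)
  then have "qpoch ?q ?q n * qpoch (?q * ?q ^ n) ?q m = qpoch ?q ?q m * qpoch (?q * ?q ^ m) ?q n"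
    unfolding qpoch_add .
  then have "qpoch (?q * ?q ^ n) ?q m = qpoch ?q ?q m * qpoch (?q * ?q ^ m) ?q n / qpoch ?q ?q n"
    using qpoch_q_nonzero[OF q, of n] by (simp add: eq_divide_eq mult_ac)
  then show ?thesis
    unfolding qlag_factor_def m b by (simp add: mult_ac)
qed (simp add: qlag_factor_def)

text \<open>
  The zeroth moment of the weight, a limit case of Ramanujan's \<open>q\<close>-beta integral. For
  \<open>-1 < \<beta> < 0\<close> and for \<open>\<beta> = 0\<close> the recurrence in \<open>N\<close> evaluates the integrals over the finite
  products, and \<open>N\<close> tends to infinity. The recurrence in \<open>\<beta>\<close> reaches all other exponents. The
  logarithm at the natural numbers thus comes from the start at \<open>\<beta> = 0\<close>, and the
  indeterminate quotient of the generic formula never has to be resolved.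
\<close>

theorem moment_mellin_kernel_inf:
  assumes q: "0 < q" "q < 1" and \<beta>: "\<beta> > -1"
  obtains L where "has_bochner_integral lborel (mellin_kernel_inf q (\<beta> + 1)) L"
    "complex_of_real L = - qlag_factor q 0 \<beta>"
proof -
  let ?q = "complex_of_real q"
  have zero: "\<exists>L. has_bochner_integral lborel (mellin_kernel_inf q (0 + 1)) L \<and>
      complex_of_real L = - qlag_factor q 0 0"
  proof -
    have H: "has_bochner_integral lborel (mellin_kernel q 1 (2 + N)) (- ln q / (1 - q ^ Suc N))" for N
    proof (induction N)
      case 0
      then show ?case using has_bochner_integral_one_over_two_factors[OF q] by simp
    next
      case (Suc N)
      have "q powr (real (2 + N) - 1) = q ^ Suc N"
        using q powr_realpow[of q "Suc N"] by (simp add: algebra_simps)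
      moreover have "q ^ Suc N < 1" using q by (intro power_Suc_less_one) auto
      ultimately show ?case
        using mellin_kernel_step[OF q _ Suc] by (simp del: power_Suc)
    qed
    obtain L where L: "has_bochner_integral lborel (mellin_kernel_inf q 1) L"
      "(\<lambda>N. - ln q / (1 - q ^ Suc N)) \<longlonglongrightarrow> L"
      by (rule has_bochner_integral_mellin_kernel_inf[OF q H])
    have "(\<lambda>N. - ln q / (1 - q ^ Suc N)) \<longlonglongrightarrow> - ln q / (1 - 0)"
      using q by (intro tendsto_intros LIMSEQ_Suc LIMSEQ_realpow_zero) auto
    with L(2) have "L = - ln q" using LIMSEQ_unique by fastforce
    with L(1) show ?thesis by (auto simp: qlag_factor_def)
  qed
  have neg: "\<exists>L. has_bochner_integral lborel (mellin_kernel_inf q (b + 1)) L \<and>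
      complex_of_real L = - qlag_factor q 0 b" if b: "-1 < b" "b < 0" for b
  proof -
    define I where "I = (\<lambda>N. pi / sin (pi * (b + 1)) *
       (\<Prod>j<N. (1 - q powr (- b) * q ^ j) / (1 - q * q ^ j)))"
    have H: "has_bochner_integral lborel (mellin_kernel q (b + 1) (1 + N)) (I N)" for N
    proof (induction N)
      case 0
      then show ?case using has_bochner_integral_powr_over_one_plus[of "b + 1" q] b
        by (simp add: I_def)
    next
      case (Suc N)
      have "q powr (real (1 + N) - (b + 1)) = q powr (- b) * q ^ N"
        using q by (simp add: powr_realpow[symmetric] flip: powr_add)
      moreover have "I (Suc N) = (1 - q powr (- b) * q ^ N) / (1 - q ^ (1 + N)) * I N"
        by (simp add: I_def)
      moreover have "has_bochner_integral lborel (mellin_kernel q (b + 1) (Suc (1 + N)))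
          ((1 - q powr (real (1 + N) - (b + 1))) / (1 - q ^ (1 + N)) * I N)"
        by (rule mellin_kernel_step[OF q _ Suc]) simp
      ultimately show ?case by (simp only: add_Suc_right)
    qed
    obtain L where L: "has_bochner_integral lborel (mellin_kernel_inf q (b + 1)) L" "I \<longlonglongrightarrow> L"
      by (rule has_bochner_integral_mellin_kernel_inf[OF q H])
    have "complex_of_real (I N) = of_real (pi / sin (pi * (b + 1))) *
        (qpoch (of_real (q powr (- b))) ?q N / qpoch ?q ?q N)" for N
      by (simp add: I_def qpoch_def prod_dividef)
    moreover have "(\<lambda>N. of_real (pi / sin (pi * (b + 1))) *
        (qpoch (of_real (q powr (- b))) ?q N / qpoch ?q ?q N)) \<longlonglongrightarrow>
        of_real (pi / sin (pi * (b + 1))) * (qpoch_inf (of_real (q powr (- b))) ?q / qpoch_inf ?q ?q)"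
      by (intro tendsto_intros qpoch_tendsto norm_q q qpoch_inf_nonzero)
    moreover have "(\<lambda>N. complex_of_real (I N)) \<longlonglongrightarrow> of_real L"
      using L(2) by (rule tendsto_of_real)
    ultimately have "of_real L = of_real (pi / sin (pi * (b + 1))) *
        (qpoch_inf (of_real (q powr (- b))) ?q / qpoch_inf ?q ?q)"
      using LIMSEQ_unique by fastforce
    moreover have "sin (pi * (b + 1)) = - sin (pi * b)"
      by (simp add: distrib_left sin_add)
    moreover have "b \<notin> \<nat>"
      using b by (auto elim: Nats_cases)
    ultimately have "of_real L = - qlag_factor q 0 b"
      by (simp add: qlag_factor_def)
    with L(1) show ?thesis by blast
  qed
  have all: "\<exists>L. has_bochner_integral lborel (mellin_kernel_inf q (b + real m + 1)) L \<and>
      complex_of_real L = - qlag_factor q 0 (b + real m)" if b: "-1 < b" "b \<le> 0" for b m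
  proof (induction m)
    case 0
    then show ?case using zero neg[of b] b by (cases "b = 0") auto
  next
    case (Suc m)
    then obtain L where L: "has_bochner_integral lborel (mellin_kernel_inf q (b + real m + 1)) L"
      "complex_of_real L = - qlag_factor q 0 (b + real m)" by blast
    have eq: "b + real (Suc m) = (b + real m) + 1" by simp
    have gt: "b + real m > -1" using b by simp
    have "complex_of_real ((q powr (- (b + real m + 1)) - 1) * L) = - qlag_factor q 0 (b + real (Suc m))"
      unfolding eq qlag_factor_step[OF q gt] of_real_mult L(2) by simp
    with mellin_kernel_inf_step[OF q L(1)] show ?case
      unfolding eq by blast
  qed
  define m where "m = nat \<lceil>\<beta>\<rceil>"
  have "\<lceil>\<beta>\<rceil> \<ge> 0" using \<beta> by linarith
  then have "real m = of_int \<lceil>\<beta>\<rceil>" by (simp add: m_def)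
  then have "-1 < \<beta> - real m" "\<beta> - real m \<le> 0" by linarith+
  from all[OF this, of m] show ?thesis using that by auto
qed

section \<open>Moments of the q-Laguerre polynomials\<close>

text \<open>
  Here \<open>b = q\<^sup>\<beta>\<^sup>+\<^sup>1\<close> and \<open>\<mu> m\<close> is the moment of \<open>x\<^sup>\<beta>\<^sup>+\<^sup>m\<close>, entering through its recurrence. The moment
  of \<open>x\<^sup>k\<close> against the \<open>n\<close>-th polynomial is the \<open>q\<close>-Chu-Vandermonde sum at \<open>a = q\<^sup>-\<^sup>k\<close> and
  \<open>c = b\<close>. In particular it vanishes for \<open>k < n\<close>, which is orthogonality.
\<close>

lemma laguerre_moment:
  fixes b :: complex and \<mu> :: "nat \<Rightarrow> complex"
  assumes q: "0 < q" "q < 1" and b: "norm b < 1" "b \<noteq> 0"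
    and \<mu>: "\<And>m. \<mu> (Suc m) = (1 / (b * of_real q ^ m) - 1) * \<mu> m"
  shows "(\<Sum>j\<le>n. qpoch b (of_real q) n / qpoch (of_real q) (of_real q) n
      * (qpoch (inverse (of_real q ^ n)) (of_real q) j
          / (qpoch (of_real q) (of_real q) j * qpoch b (of_real q) j)
          * of_real q ^ (j choose 2) * (of_real q ^ n * b) ^ j) * \<mu> (j + k))
    = \<mu> k * qpoch (inverse (of_real q ^ k)) (of_real q) n / qpoch (of_real q) (of_real q) n"
proof -
  let ?q = "complex_of_real q"
  have Q0: "?q \<noteq> 0" using q by simp
  note q0 = qpoch_q_nonzero[OF q]
  have b0: "qpoch b ?q j \<noteq> 0" for j
    by (intro qpoch_nonzero norm_q q b)
  have mu: "\<mu> (j + k) * b ^ j * ?q ^ (j choose 2) = \<mu> k * (\<Prod>i<j. inverse (?q ^ k) - b * ?q ^ i)" for j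
  proof (induction j)
    case (Suc j)
    have "\<mu> (Suc j + k) * b ^ Suc j * ?q ^ (Suc j choose 2)
        = ((1 / (b * ?q ^ (j + k)) - 1) * (b * ?q ^ j)) * (\<mu> (j + k) * b ^ j * ?q ^ (j choose 2))"
      by (simp add: \<mu> choose_two_Suc power_add)
    also have "(1 / (b * ?q ^ (j + k)) - 1) * (b * ?q ^ j) = inverse (?q ^ k) - b * ?q ^ j"
      using Q0 b by (simp add: power_add field_simps)
    finally show ?case unfolding Suc by (simp add: mult_ac)
  qed (simp add: binomial_eq_0)
  have "qpoch b ?q n / qpoch ?q ?q n
      * (qpoch (inverse (?q ^ n)) ?q j / (qpoch ?q ?q j * qpoch b ?q j)
          * ?q ^ (j choose 2) * (?q ^ n * b) ^ j) * \<mu> (j + k)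
    = \<mu> k / qpoch ?q ?q n * (qbinom ?q n j * (-1) ^ j * ?q ^ (j choose 2)
      * (\<Prod>i<j. inverse (?q ^ k) - b * ?q ^ i) * qpoch (b * ?q ^ j) ?q (n - j))" if j: "j \<le> n" for j
  proof -
    have B: "qpoch b ?q n = qpoch b ?q j * qpoch (b * ?q ^ j) ?q (n - j)"
      using qpoch_add[of b ?q j "n - j"] j by simp
    have "qpoch (inverse (?q ^ n)) ?q j * ?q ^ (n * j) * qpoch ?q ?q (n - j)
        = ((-1) ^ j * ?q ^ (j choose 2) * qbinom ?q n j * qpoch ?q ?q j) * qpoch ?q ?q (n - j)"
      using qpoch_inverse_power[OF Q0 j] by (simp add: mult.assoc flip: qbinom_mult_qpoch[OF j])
    then have P: "qpoch (inverse (?q ^ n)) ?q j * ?q ^ (n * j)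
        = (-1) ^ j * ?q ^ (j choose 2) * qbinom ?q n j * qpoch ?q ?q j"
      using q0[of "n - j"] by simp
    have "qpoch b ?q n / qpoch ?q ?q n
      * (qpoch (inverse (?q ^ n)) ?q j / (qpoch ?q ?q j * qpoch b ?q j)
          * ?q ^ (j choose 2) * (?q ^ n * b) ^ j) * \<mu> (j + k)
      = qpoch b ?q n / qpoch b ?q j / qpoch ?q ?q n / qpoch ?q ?q j
      * (qpoch (inverse (?q ^ n)) ?q j * ?q ^ (n * j)) * (\<mu> (j + k) * b ^ j * ?q ^ (j choose 2))"
    proof -
      have "(?q ^ n * b) ^ j = ?q ^ (n * j) * b ^ j"
        by (simp add: power_mult_distrib power_mult)
      then show ?thesis by (simp add: mult_ac)
    qed
    also have "\<dots> = \<mu> k / qpoch ?q ?q n * (qbinom ?q n j * (-1) ^ j * ?q ^ (j choose 2)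
      * (\<Prod>i<j. inverse (?q ^ k) - b * ?q ^ i) * qpoch (b * ?q ^ j) ?q (n - j))"
      unfolding P mu B using b0[of j] q0[of j] by (simp add: mult_ac)
    finally show ?thesis .
  qed
  then have "(\<Sum>j\<le>n. qpoch b ?q n / qpoch ?q ?q n
      * (qpoch (inverse (?q ^ n)) ?q j / (qpoch ?q ?q j * qpoch b ?q j)
          * ?q ^ (j choose 2) * (?q ^ n * b) ^ j) * \<mu> (j + k))
    = \<mu> k / qpoch ?q ?q n * qpoch (inverse (?q ^ k)) ?q n"
    unfolding q_chu_vandermonde[of ?q n "inverse (?q ^ k)" b, symmetric]
    by (simp add: sum_distrib_left)
  then show ?thesis by simp
qed

lemma moment_closed_form:
  fixes b :: complex and \<mu> :: "nat \<Rightarrow> complex"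
  assumes "q \<noteq> 0" "b \<noteq> 0" and \<mu>: "\<And>m. \<mu> (Suc m) = (1 / (b * q ^ m) - 1) * \<mu> m"
  shows "\<mu> k * (b ^ k * q ^ (k choose 2)) = \<mu> 0 * qpoch b q k"
proof (induction k)
  case (Suc k)
  have "\<mu> (Suc k) * (b ^ Suc k * q ^ (Suc k choose 2))
      = ((1 / (b * q ^ k) - 1) * (b * q ^ k)) * (\<mu> k * (b ^ k * q ^ (k choose 2)))"
    by (simp add: \<mu> choose_two_Suc power_add)
  also have "(1 / (b * q ^ k) - 1) * (b * q ^ k) = 1 - b * q ^ k"
    using assms by (simp add: field_simps)
  finally show ?case unfolding Suc by (simp add: qpoch_Suc)
qed (simp add: binomial_eq_0)

section \<open>Termwise integration\<close>

text \<open>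
  In a term of index \<open>k = m + n\<close> of the integrated series, every \<open>q\<close>-shifted factorial of length
  \<open>m + n\<close> splits into one of length \<open>n\<close> and a shifted one of length \<open>m\<close>, and the powers of \<open>q\<close>
  regroup by \<open>2 (k choose 2) + n = 2 (m choose 2) + n m + k n\<close>. With \<open>a = A b\<close>, \<open>C = a q\<^sup>n\<close> and
  \<open>z = t q\<^sup>n\<close> this leaves a factor free of \<open>m\<close> times the \<open>m\<close>-th term of the second series of the
  transformation.
\<close>

lemma shifted_term:
  fixes A b t :: complex and \<mu> :: "nat \<Rightarrow> complex"
  assumes q: "0 < q" "q < 1" and b: "b \<noteq> 0" and t: "norm t < 1"
    and \<mu>: "\<And>m. \<mu> (Suc m) = (1 / (b * of_real q ^ m) - 1) * \<mu> m"
  defines "Q \<equiv> complex_of_real q"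
  shows "(Q ^ ((m + n) choose 2)) ^ 3 * (t * (A * b)) ^ (m + n)
        / (qpoch Q Q (m + n) * qpoch (A * b) Q (m + n) * qpoch t Q (m + n))
        * (\<mu> (m + n) * qpoch (inverse (Q ^ (m + n))) Q n / qpoch Q Q n)
    = \<mu> 0 * qpoch b Q n / qpoch Q Q n * (- t * A) ^ n * Q ^ (n choose 2)
        / (Q ^ n * qpoch_inf t Q * qpoch (A * b) Q n)
      * ((Q ^ (m choose 2))\<^sup>2 * (\<Prod>i<m. A - A * b * Q ^ n * Q ^ i) * (t * Q ^ n) ^ m
         * qpoch_inf (t * Q ^ n * Q ^ m) Q / (qpoch Q Q m * qpoch (A * b * Q ^ n) Q m))"
proof -
  have Q0: "Q \<noteq> 0" using q by (simp add: Q_def)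
  have nQ: "norm Q < 1" unfolding Q_def by (rule norm_q[OF q])
  have q0: "qpoch Q Q k \<noteq> 0" for k
    by (intro qpoch_nonzero nQ)
  have ti0: "qpoch_inf t Q \<noteq> 0"
    by (intro qpoch_inf_nonzero nQ t)
  define k where "k = m + n"
  define s where "s = Q ^ (k choose 2)"
  have s0: "s \<noteq> 0" using Q0 by (simp add: s_def)
  have mu: "\<mu> k = \<mu> 0 * qpoch b Q k / (b ^ k * s)"
    using moment_closed_form[OF Q0 b, of \<mu> k] \<mu> s0 b unfolding Q_def[symmetric]
    by (simp add: eq_divide_eq s_def)
  have ip: "qpoch (inverse (Q ^ k)) Q n = (-1) ^ n * Q ^ (n choose 2) * qpoch Q Q k / (Q ^ (k * n) * qpoch Q Q m)"
    using qpoch_inverse_power[OF Q0, of n k] q0[of m] Q0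
    by (simp add: eq_divide_eq k_def mult_ac)
  have bk: "qpoch b Q k = qpoch b Q n * qpoch (b * Q ^ n) Q m"
    and ak: "qpoch (A * b) Q k = qpoch (A * b) Q n * qpoch (A * b * Q ^ n) Q m"
    unfolding k_def add.commute[of m n] by (rule qpoch_add)+
  have tk: "qpoch t Q k = qpoch_inf t Q / qpoch_inf (t * Q ^ n * Q ^ m) Q"
    and ti1: "qpoch_inf (t * Q ^ n * Q ^ m) Q \<noteq> 0"
  proof -
    have "qpoch_inf t Q = qpoch t Q k * qpoch_inf (t * Q ^ n * Q ^ m) Q"
      using qpoch_inf_split[OF nQ, of t k] by (simp add: k_def power_add mult_ac)
    with ti0 show "qpoch t Q k = qpoch_inf t Q / qpoch_inf (t * Q ^ n * Q ^ m) Q"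
      "qpoch_inf (t * Q ^ n * Q ^ m) Q \<noteq> 0" by (auto simp: field_simps)
  qed
  have pr: "(\<Prod>i<m. A - A * b * Q ^ n * Q ^ i) = A ^ m * qpoch (b * Q ^ n) Q m"
  proof -
    have "(\<Prod>i<m. A - A * b * Q ^ n * Q ^ i) = (\<Prod>i<m. A * (1 - b * Q ^ n * Q ^ i))"
      by (simp add: algebra_simps)
    then show ?thesis by (simp add: prod.distrib qpoch_def)
  qed
  have sq: "s\<^sup>2 * Q ^ n = (Q ^ (m choose 2))\<^sup>2 * Q ^ (n * m) * Q ^ (k * n)"
  proof -
    have "2 * (n choose 2) + n = n * n"
      by (induction n) (simp_all add: choose_two_Suc binomial_eq_0)
    then have "2 * (k choose 2) + n = 2 * (m choose 2) + n * m + k * n"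
      unfolding k_def choose_two_add by (simp add: algebra_simps)
    then have "Q ^ (2 * (k choose 2) + n) = Q ^ (2 * (m choose 2) + n * m + k * n)" by simp
    then show ?thesis by (simp add: s_def power_add power_mult mult.commute[of 2])
  qed
  have s2: "s\<^sup>2 / Q ^ (k * n) = (Q ^ (m choose 2))\<^sup>2 * Q ^ (n * m) / Q ^ n"
    using sq Q0 by (simp add: field_simps)
  have tA: "(t * A) ^ k = (t * A) ^ n * (t ^ m * A ^ m)"
    by (simp add: k_def power_add power_mult_distrib)
  have sg: "(-1) ^ n * (t * A) ^ n = (- t * A) ^ n"
    by (simp flip: power_mult_distrib)
  have zm: "(t * Q ^ n) ^ m = t ^ m * Q ^ (n * m)"
    by (simp add: power_mult_distrib power_mult)
  have "s ^ 3 * (t * (A * b)) ^ k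
        / (qpoch Q Q k * qpoch (A * b) Q k * qpoch t Q k)
        * (\<mu> k * qpoch (inverse (Q ^ k)) Q n / qpoch Q Q n)
     = \<mu> 0 * (s\<^sup>2 / Q ^ (k * n)) * (t * A) ^ k * (-1) ^ n * Q ^ (n choose 2) * qpoch b Q k
       / (qpoch (A * b) Q k * qpoch t Q k * qpoch Q Q m * qpoch Q Q n)"
  proof -
    have "(t * (A * b)) ^ k = (t * A) ^ k * b ^ k" by (simp add: power_mult_distrib)
    then show ?thesis
      unfolding mu ip using s0 b q0[of k] by (simp add: power3_eq_cube power2_eq_square mult_ac)
  qed
  also have "\<dots> = \<mu> 0 * qpoch b Q n / qpoch Q Q n * ((-1) ^ n * (t * A) ^ n) * Q ^ (n choose 2)
        / (Q ^ n * qpoch_inf t Q * qpoch (A * b) Q n)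
      * ((Q ^ (m choose 2))\<^sup>2 * (A ^ m * qpoch (b * Q ^ n) Q m) * (t ^ m * Q ^ (n * m))
         * qpoch_inf (t * Q ^ n * Q ^ m) Q / (qpoch Q Q m * qpoch (A * b * Q ^ n) Q m))"
    unfolding s2 tA bk ak tk by (simp add: mult_ac)
  finally show ?thesis unfolding pr sg zm by (simp add: s_def k_def)
qed

text \<open>
  Since the functions \<open>K k\<close> are nonnegative, the integrals of the absolute values of the terms are
  \<open>norm (c k) * L k\<close>, so the second summability assumption is the one that dominated
  convergence asks for.
\<close>

lemma has_bochner_integral_series:
  fixes K :: "nat \<Rightarrow> 'a \<Rightarrow> real" and c :: "nat \<Rightarrow> complex"
  assumes K: "\<And>k. has_bochner_integral M (K k) (L k)"
    and nn: "\<And>k x. K k x \<ge> 0"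
    and s1: "\<And>x. summable (\<lambda>k. norm (c k) * K k x)"
    and s2: "summable (\<lambda>k. norm (c k) * L k)"
  shows "has_bochner_integral M (\<lambda>x. \<Sum>k. c k * of_real (K k x)) (\<Sum>k. c k * of_real (L k))"
    and "summable (\<lambda>k. c k * of_real (L k))"
proof -
  have hb: "has_bochner_integral M (\<lambda>x. c k * of_real (K k x)) (c k * of_real (L k))" for k
    by (intro has_bochner_integral_mult_right has_bochner_integral_of_real K)
  then have i: "integrable M (\<lambda>x. c k * of_real (K k x))"
    and v: "(\<integral>x. c k * of_real (K k x) \<partial>M) = c k * of_real (L k)" for k
    by (auto simp: has_bochner_integral_iff)
  have vn: "(\<integral>x. norm (c k * of_real (K k x)) \<partial>M) = norm (c k) * L k" for k
    using K[of k] nn by (simp add: norm_mult has_bochner_integral_iff)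
  have a: "AE x in M. summable (\<lambda>k. norm (c k * of_real (K k x)))"
    using s1 nn by (simp add: norm_mult)
  have b: "summable (\<lambda>k. \<integral>x. norm (c k * of_real (K k x)) \<partial>M)"
    unfolding vn by (rule s2)
  show "has_bochner_integral M (\<lambda>x. \<Sum>k. c k * of_real (K k x)) (\<Sum>k. c k * of_real (L k))"
    using integrable_suminf[OF i a b] integral_suminf[OF i a b]
    unfolding has_bochner_integral_iff v by blast
  show "summable (\<lambda>k. c k * of_real (L k))"
    using summable_integral[OF i a b] unfolding v .
qed

section \<open>The integrand as a series in powers of the variable\<close>

lemma qhyp_0_2_power_series:
  "qhyp [] [a, t] Q (- x * t * a)
    = (\<Sum>k. (Q ^ (k choose 2)) ^ 3 * (t * a) ^ k / (qpoch Q Q k * qpoch a Q k * qpoch t Q k) * x ^ k)"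
proof -
  have *: "((- 1) ^ k * w) ^ 3 * (- x * t * a) ^ k = w ^ 3 * (t * a) ^ k * x ^ k" for k and w :: complex
  proof -
    have "(- x * t * a) ^ k = (-1) ^ k * (t * a) ^ k * x ^ k"
      by (simp add: mult_ac flip: power_mult_distrib)
    moreover have "((- 1 :: complex) ^ k) ^ 3 * (- 1) ^ k = 1"
      by (cases "even k") auto
    ultimately show ?thesis by (simp add: power_mult_distrib mult_ac)
  qed
  have "(3 :: int) = int 3" by simp
  then have p3: "w powi 3 = w ^ 3" for w :: complex
    by (simp only: power_int_of_nat)
  have "qhyp [] [a, t] Q (- x * t * a)
      = (\<Sum>k. ((- 1) ^ k * Q ^ (k choose 2)) ^ 3 * (- x * t * a) ^ k
          / (qpoch Q Q k * qpoch a Q k * qpoch t Q k))"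
    by (simp add: qhyp_def p3 mult.assoc)
  also have "\<dots> = (\<Sum>k. (Q ^ (k choose 2)) ^ 3 * (t * a) ^ k
      / (qpoch Q Q k * qpoch a Q k * qpoch t Q k) * x ^ k)"
    unfolding * by simp
  finally show ?thesis .
qed

lemma qhyp_0_2_coeff_step:
  fixes Q a t :: complex
  assumes Q: "norm Q < 1" and a: "norm a < 1" and t: "norm t < 1"
  defines "c \<equiv> (\<lambda>k. (Q ^ (k choose 2)) ^ 3 * (t * a) ^ k
    / (qpoch Q Q k * qpoch a Q k * qpoch t Q k))"
  shows "norm (c (Suc k)) \<le> norm (t * a) / ((1 - norm Q) * (1 - norm a) * (1 - norm t))
    * (norm Q ^ k) ^ 3 * norm (c k)"
proof -
  have "c (Suc k) = t * a / ((1 - Q * Q ^ k) * (1 - a * Q ^ k) * (1 - t * Q ^ k))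
      * (Q ^ k) ^ 3 * c k"
    by (simp add: c_def qpoch_Suc choose_two_Suc power_add power_mult_distrib mult_ac)
  then have "norm (c (Suc k)) = norm (t * a) / (norm (1 - Q * Q ^ k)
      * norm (1 - a * Q ^ k) * norm (1 - t * Q ^ k)) * (norm Q ^ k) ^ 3 * norm (c k)"
    by (simp only: norm_mult norm_divide norm_power)
  also have "\<dots> \<le> norm (t * a) / ((1 - norm Q) * (1 - norm a) * (1 - norm t))
      * (norm Q ^ k) ^ 3 * norm (c k)"
    using assms(1-3) norm_one_minus_ge[OF Q]
    by (intro mult_right_mono frac_le mult_mono) auto
  finally show ?thesis .
qed

lemma q_laguerre_sum:
  fixes q \<beta> :: real
  assumes q: "0 < q"
  defines "Q \<equiv> complex_of_real q" and "b \<equiv> complex_of_real (q powr (\<beta> + 1))"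
  shows "q_laguerre n \<beta> q x = (\<Sum>j\<le>n. qpoch b Q n / qpoch Q Q n * (qpoch (inverse (Q ^ n)) Q j
    / (qpoch Q Q j * qpoch b Q j) * Q ^ (j choose 2) * (Q ^ n * b) ^ j) * x ^ j)"
proof -
  have Q0: "Q \<noteq> 0" using q by (simp add: Q_def)
  have p: "complex_of_real (q powr (- real n)) = inverse (Q ^ n)"
    using q by (simp add: powr_minus powr_realpow Q_def)
  have p': "complex_of_real (q powr (real n + \<beta> + 1)) = Q ^ n * b"
    using q by (simp add: Q_def b_def powr_add powr_realpow)
  have "qhyp [inverse (Q ^ n)] [b] Q (- (Q ^ n * b) * x)
      = (\<Sum>j. qpoch (inverse (Q ^ n)) Q j / (qpoch Q Q j * qpoch b Q j)
          * ((-1) ^ j * Q ^ (j choose 2)) * (- (Q ^ n * b) * x) ^ j)"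
    by (simp add: qhyp_def)
  also have "\<dots> = (\<Sum>j\<le>n. qpoch (inverse (Q ^ n)) Q j / (qpoch Q Q j * qpoch b Q j)
          * ((-1) ^ j * Q ^ (j choose 2)) * (- (Q ^ n * b) * x) ^ j)"
    by (rule suminf_finite) (auto simp: qpoch_inverse_power_eq_0[OF Q0])
  also have "\<dots> = (\<Sum>j\<le>n. qpoch (inverse (Q ^ n)) Q j / (qpoch Q Q j * qpoch b Q j)
          * Q ^ (j choose 2) * (Q ^ n * b) ^ j * x ^ j)"
  proof (rule sum.cong[OF refl])
    fix j
    have "(- (Q ^ n * b) * x) ^ j = (-1) ^ j * (Q ^ n * b) ^ j * x ^ j"
      by (simp flip: power_mult_distrib)
    moreover have "(- 1 :: complex) ^ j * (- 1) ^ j = 1"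
      by (simp flip: power_mult_distrib)
    ultimately show "qpoch (inverse (Q ^ n)) Q j / (qpoch Q Q j * qpoch b Q j)
          * ((-1) ^ j * Q ^ (j choose 2)) * (- (Q ^ n * b) * x) ^ j
        = qpoch (inverse (Q ^ n)) Q j / (qpoch Q Q j * qpoch b Q j)
          * Q ^ (j choose 2) * (Q ^ n * b) ^ j * x ^ j"
      by simp
  qed
  finally show ?thesis
    unfolding q_laguerre_def p p' b_def[symmetric] Q_def[symmetric]
    by (simp add: sum_distrib_left mult.assoc)
qed

lemma qpoch_inf_minus_of_real:
  fixes q x :: real
  assumes q: "0 < q" "q < 1"
  shows "qpoch_inf (- of_real x) (of_real q) = of_real (\<Prod>j. 1 + x * q ^ j)"
proof -
  have "(\<lambda>N. complex_of_real (\<Prod>j<N. 1 + x * q ^ j)) \<longlonglongrightarrow> of_real (\<Prod>j. 1 + x * q ^ j)"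
    by (intro tendsto_of_real has_prod_imp_tendsto' convergent_prod_has_prod
        convergent_prod_one_plus q)
  moreover have "complex_of_real (\<Prod>j<N. 1 + x * q ^ j) = qpoch (- of_real x) (of_real q) N" for N
    by (simp add: qpoch_def)
  ultimately have "qpoch (- of_real x) (of_real q) \<longlonglongrightarrow> of_real (\<Prod>j. 1 + x * q ^ j)" by simp
  then show ?thesis
    using qpoch_tendsto[OF norm_q[OF q]] LIMSEQ_unique by blast
qed

section \<open>The integral\<close>

theorem corollary26:
  fixes q \<alpha> \<beta> :: real and n :: nat and t :: complex
  assumes "0 < q" and "q < 1"
    and "\<alpha> > -1" and "\<beta> > -1"
    and "cmod t < (1 - q powr (\<alpha> + 1)) * (1 - q)"
  defines "f \<equiv> (\<lambda>x::real.
      qhyp [] [of_real (q powr (\<alpha> + 1)), t] (of_real q)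
        (- of_real x * t * of_real (q powr (\<alpha> + 1)))
      * q_laguerre n \<beta> q (of_real x)
      * (of_real (x powr \<beta>) / qpoch_inf (- of_real x) (of_real q)))"
  shows "set_integrable lborel {0<..} f \<and>
    (LINT x:{0<..}|lborel. f x) =
      - ((- t * of_real (q powr (\<alpha> - \<beta>))) ^ n) * of_real (q ^ (n choose 2))
      / (of_real (q ^ n) * qpoch_inf t (of_real q)
         * qpoch (of_real (q powr (\<alpha> + 1))) (of_real q) n)
      * qhyp [of_real (q powr (\<alpha> - \<beta>))] [of_real (q powr (\<alpha> + real n + 1))] (of_real q)
          (t * of_real (q ^ n))
      * qlag_factor q n \<beta>"
proof -
  note q = assms(1,2)
  define Q where "Q = complex_of_real q"
  define A where "A = complex_of_real (q powr (\<alpha> - \<beta>))"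
  define b where "b = complex_of_real (q powr (\<beta> + 1))"
  have a_eq: "complex_of_real (q powr (\<alpha> + 1)) = A * b"
    by (simp add: A_def b_def flip: of_real_mult powr_add)
  have lt1: "q powr r < 1" if "r > 0" for r
    using q that powr_less_mono'[of q 0 r] by simp
  have nQ: "norm Q < 1" unfolding Q_def by (rule norm_q[OF q])
  have b1: "norm b < 1" "b \<noteq> 0"
    using lt1[of "\<beta> + 1"] assms(1,4) by (auto simp: b_def)
  have ab1: "norm (A * b) < 1"
    unfolding a_eq[symmetric] using lt1[of "\<alpha> + 1"] assms(3) by simp
  have t1: "norm t < 1"
  proof -
    have "(1 - q powr (\<alpha> + 1)) * (1 - q) \<le> 1 * 1"
      using q lt1[of "\<alpha> + 1"] assms(3) by (intro mult_mono) auto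
    with assms(5) show ?thesis by simp
  qed
  have Q0: "Q \<noteq> 0" using q by (simp add: Q_def)

  \<comment> \<open>The kernels \<open>K m\<close> are the weight times \<open>x\<^sup>\<beta>\<^sup>+\<^sup>m\<close>. Their integrals are nonnegative reals; \<open>\<mu>\<close> is
    the same sequence among the complex numbers.\<close>
  define K where "K = (\<lambda>m. mellin_kernel_inf q (\<beta> + 1 + real m))"
  define L where "L = (\<lambda>m. integral\<^sup>L lborel (K m))"
  have K_nonneg: "K m x \<ge> 0" for m x
    unfolding K_def by (rule mellin_kernel_inf_nonneg[OF q])
  have K_Suc: "K (Suc m) x = x * K m x" for m x
    by (cases "x > 0") (auto simp: K_def mellin_kernel_inf_def powr_add algebra_simps)
  have K_int: "has_bochner_integral lborel (K m) (L m)" for m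
  proof (induction m)
    case 0
    show ?case
      using moment_mellin_kernel_inf[OF q assms(4)]
      by (auto simp: K_def L_def has_bochner_integral_iff)
  next
    case (Suc m)
    from mellin_kernel_inf_step[OF q Suc[unfolded K_def]]
    have "integrable lborel (K (Suc m))"
      by (simp add: K_def has_bochner_integral_iff add_ac)
    then show ?case by (simp add: L_def has_bochner_integral_iff)
  qed
  have L_nonneg: "L m \<ge> 0" for m
    unfolding L_def by (intro Bochner_Integration.integral_nonneg K_nonneg)
  have L_Suc: "L (Suc m) = (q powr (- (\<beta> + 1 + real m)) - 1) * L m" for m
  proof -
    have "\<beta> + 1 + real (Suc m) = \<beta> + 1 + real m + 1" by simp
    then show ?thesis
      using mellin_kernel_inf_step[OF q K_int[of m, unfolded K_def]]
      by (simp only: L_def K_def has_bochner_integral_iff)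
  qed
  have q_powr: "q powr (- (\<beta> + 1 + real m)) = 1 / (q powr (\<beta> + 1) * q ^ m)" for m
  proof -
    have "q powr (\<beta> + 1 + real m) = q powr (\<beta> + 1) * q ^ m"
      using q by (simp add: powr_add[of q "\<beta> + 1" "real m"] powr_realpow)
    then show ?thesis by (simp only: powr_minus divide_inverse mult_1)
  qed
  define \<mu> where "\<mu> = (\<lambda>m. complex_of_real (L m))"
  have mu_Suc: "\<mu> (Suc m) = (1 / (b * of_real q ^ m) - 1) * \<mu> m" for m
    unfolding \<mu>_def L_Suc q_powr b_def by simp
  have mu_0: "\<mu> 0 = - qlag_factor q 0 \<beta>"
  proof -
    obtain L0 where "has_bochner_integral lborel (mellin_kernel_inf q (\<beta> + 1)) L0"
      "complex_of_real L0 = - qlag_factor q 0 \<beta>"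
      using moment_mellin_kernel_inf[OF q assms(4)] .
    then show ?thesis by (simp add: \<mu>_def L_def K_def has_bochner_integral_iff)
  qed

  \<comment> \<open>The integrand is a double sum over \<open>c k * l j\<close> times \<open>K (k + j)\<close>, with \<open>c\<close> from the
    \<open>\<^sub>0\<phi>\<^sub>2\<close> series and \<open>l\<close> from the polynomial. Consecutive \<open>c\<close> have a ratio of order \<open>q\<^sup>3\<^sup>k\<close>,
    while that of the moments grows only like \<open>q\<^sup>-\<^sup>k\<close>, so the sum over \<open>k\<close> may be integrated termwise.\<close>
  define c where "c = (\<lambda>k. (Q ^ (k choose 2)) ^ 3 * (t * (A * b)) ^ k
        / (qpoch Q Q k * qpoch (A * b) Q k * qpoch t Q k))"
  define l where "l = (\<lambda>j. qpoch b Q n / qpoch Q Q n * (qpoch (inverse (Q ^ n)) Q j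
        / (qpoch Q Q j * qpoch b Q j) * Q ^ (j choose 2) * (Q ^ n * b) ^ j))"
  define R where "R = norm (t * (A * b)) / ((1 - q) * (1 - norm (A * b)) * (1 - norm t))"
  have R0: "R \<ge> 0" using q ab1 t1 by (simp add: R_def)
  have c_Suc: "norm (c (Suc k)) \<le> R * q ^ k * q ^ k * q ^ k * norm (c k)" for k
    using qhyp_0_2_coeff_step[OF nQ ab1 t1, of k] q
    by (simp add: c_def R_def Q_def power3_eq_cube mult_ac)
  have qk: "(\<lambda>k. q ^ k) \<longlonglongrightarrow> 0"
    using q by (intro LIMSEQ_realpow_zero) auto
  have sum_K: "summable (\<lambda>k. norm (c k) * K (k + j) x)" for j x
  proof (rule summable_ratio_tendsto_0[where r = "\<lambda>k. R * q ^ k * q ^ k * q ^ k * \<bar>x\<bar>"])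
    fix k
    have "norm (c (Suc k)) * K (Suc k + j) x \<le> norm (c (Suc k)) * (\<bar>x\<bar> * K (k + j) x)"
      using K_nonneg[of "k + j" x] by (intro mult_left_mono) (auto simp: K_Suc intro: mult_right_mono)
    also have "\<dots> \<le> (R * q ^ k * q ^ k * q ^ k * norm (c k)) * (\<bar>x\<bar> * K (k + j) x)"
      using K_nonneg by (intro mult_right_mono c_Suc) auto
    finally show "norm (norm (c (Suc k)) * K (Suc k + j) x)
        \<le> R * q ^ k * q ^ k * q ^ k * \<bar>x\<bar> * norm (norm (c k) * K (k + j) x)"
      using K_nonneg by (simp add: abs_mult mult_ac)
    show "(\<lambda>k. R * q ^ k * q ^ k * q ^ k * \<bar>x\<bar>) \<longlonglongrightarrow> 0"
      by (rule tendsto_eq_intros qk refl | simp)+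
  qed
  have sum_L: "summable (\<lambda>k. norm (c k) * L (k + j))" for j
  proof (rule summable_ratio_tendsto_0[where r = "\<lambda>k. R / (q powr (\<beta> + 1) * q ^ j) * q ^ k * q ^ k"])
    fix k
    have "L (Suc k + j) \<le> 1 / (q powr (\<beta> + 1) * q ^ (k + j)) * L (k + j)"
      unfolding add_Suc L_Suc q_powr using L_nonneg[of "k + j"] by (simp add: left_diff_distrib)
    then have "norm (c (Suc k)) * L (Suc k + j) \<le> (R * q ^ k * q ^ k * q ^ k * norm (c k))
        * (1 / (q powr (\<beta> + 1) * q ^ (k + j)) * L (k + j))"
      using L_nonneg q R0 by (intro mult_mono c_Suc) auto
    also have "\<dots> = R / (q powr (\<beta> + 1) * q ^ j) * q ^ k * q ^ k * (norm (c k) * L (k + j))"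
      using q by (simp add: power_add)
    finally show "norm (norm (c (Suc k)) * L (Suc k + j))
        \<le> R / (q powr (\<beta> + 1) * q ^ j) * q ^ k * q ^ k * norm (norm (c k) * L (k + j))"
      using L_nonneg by (simp add: abs_mult)
    show "(\<lambda>k. R / (q powr (\<beta> + 1) * q ^ j) * q ^ k * q ^ k) \<longlonglongrightarrow> 0"
      by (rule tendsto_eq_intros qk refl | simp)+
  qed
  have series: "has_bochner_integral lborel (\<lambda>x. \<Sum>k. c k * of_real (K (k + j) x)) (\<Sum>k. c k * \<mu> (k + j))"
    and sum_mu: "summable (\<lambda>k. c k * \<mu> (k + j))" for j
    using has_bochner_integral_series[OF K_int K_nonneg sum_K sum_L, of j]
    unfolding \<mu>_def by blast+
  have total: "has_bochner_integral lborel
      (\<lambda>x. \<Sum>j\<le>n. l j * (\<Sum>k. c k * of_real (K (k + j) x))) (\<Sum>j\<le>n. l j * (\<Sum>k. c k * \<mu> (k + j)))"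
    by (intro has_bochner_integral_sum has_bochner_integral_mult_right series)

  have integrand: "indicator {0<..} x *\<^sub>R f x = (\<Sum>j\<le>n. l j * (\<Sum>k. c k * of_real (K (k + j) x)))" for x
  proof (cases "x > 0")
    case True
    have phi: "qhyp [] [of_real (q powr (\<alpha> + 1)), t] (of_real q)
        (- of_real x * t * of_real (q powr (\<alpha> + 1))) = (\<Sum>k. c k * of_real x ^ k)"
      unfolding a_eq qhyp_0_2_power_series c_def Q_def ..
    have lag: "q_laguerre n \<beta> q (of_real x) = (\<Sum>j\<le>n. l j * of_real x ^ j)"
      unfolding q_laguerre_sum[OF q(1)] l_def b_def Q_def ..
    have wt: "of_real (x powr \<beta>) / qpoch_inf (- of_real x) (of_real q) = complex_of_real (K 0 x)"
      using True by (simp add: qpoch_inf_minus_of_real[OF q] K_def mellin_kernel_inf_def)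
    have K_pow: "K m x = x ^ m * K 0 x" for m
      by (induction m) (simp_all add: K_Suc)
    have sc: "summable (\<lambda>k. c k * of_real x ^ k)"
    proof -
      have "K 0 x > 0"
      proof -
        have "K 0 x \<noteq> 0"
          using True prodinf_one_plus_nonzero[OF q, of x] by (simp add: K_def mellin_kernel_inf_def)
        with K_nonneg[of 0 x] show ?thesis by simp
      qed
      moreover have "summable (\<lambda>k. norm (c k) * x ^ k * K 0 x)"
      proof -
        have "norm (c k) * K (k + 0) x = norm (c k) * x ^ k * K 0 x" for k
          by (subst K_pow) simp
        then show ?thesis using sum_K[of 0 x] by (simp only:)
      qed
      ultimately have "summable (\<lambda>k. norm (c k) * x ^ k)"
        using summable_mult2[of "\<lambda>k. norm (c k) * x ^ k * K 0 x" "inverse (K 0 x)"]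
        by (simp add: mult.assoc)
      then have "summable (\<lambda>k. norm (c k * of_real x ^ k))"
        using True by (simp add: norm_mult norm_power)
      then show ?thesis by (rule summable_norm_cancel)
    qed
    have "(\<Sum>k. c k * of_real (K (k + j) x)) = (\<Sum>k. c k * of_real x ^ k) * (of_real x ^ j * of_real (K 0 x))" for j
    proof -
      have "(\<Sum>k. c k * of_real (K (k + j) x)) = (\<Sum>k. c k * of_real x ^ k * (of_real x ^ j * of_real (K 0 x)))"
      proof -
        have "complex_of_real (K (k + j) x) = of_real x ^ k * (of_real x ^ j * of_real (K 0 x))" for k
          by (subst K_pow) (simp add: power_add)
        then show ?thesis by (simp only: mult.assoc)
      qed
      also have "\<dots> = (\<Sum>k. c k * of_real x ^ k) * (of_real x ^ j * of_real (K 0 x))"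
        by (rule suminf_mult2[OF sc, symmetric])
      finally show ?thesis .
    qed
    then show ?thesis
      unfolding f_def phi lag wt using True
      by (simp add: sum_distrib_left sum_distrib_right mult_ac)
  next
    case False
    then show ?thesis by (simp add: K_def mellin_kernel_inf_def)
  qed
  have total': "has_bochner_integral lborel (\<lambda>x. indicator {0<..} x *\<^sub>R f x)
      (\<Sum>j\<le>n. l j * (\<Sum>k. c k * \<mu> (k + j)))"
    unfolding integrand by (rule total)

  \<comment> \<open>Exchanging the two sums leaves the Laguerre moments; those with \<open>k < n\<close> vanish, and the others
    form, up to the constant \<open>D\<close>, the second series of the transformation.\<close>
  define T where "T = (\<lambda>k. c k * (\<mu> k * qpoch (inverse (Q ^ k)) Q n / qpoch Q Q n))"
  define D where "D = \<mu> 0 * qpoch b Q n / qpoch Q Q n * (- t * A) ^ n * Q ^ (n choose 2)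
        / (Q ^ n * qpoch_inf t Q * qpoch (A * b) Q n)"
  define C where "C = A * b * Q ^ n"
  define z where "z = t * Q ^ n"
  have inner: "(\<Sum>j\<le>n. l j * (c k * \<mu> (k + j))) = T k" for k
  proof -
    have "(\<Sum>j\<le>n. l j * \<mu> (j + k)) = \<mu> k * qpoch (inverse (Q ^ k)) Q n / qpoch Q Q n"
      unfolding l_def Q_def by (rule laguerre_moment[OF q b1 mu_Suc])
    then have "T k = (\<Sum>j\<le>n. c k * (l j * \<mu> (j + k)))"
      by (simp add: T_def flip: sum_distrib_left)
    then show ?thesis by (simp add: mult_ac add.commute)
  qed
  have "(\<Sum>j\<le>n. l j * (\<Sum>k. c k * \<mu> (k + j))) = (\<Sum>j\<le>n. \<Sum>k. l j * (c k * \<mu> (k + j)))"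
    by (simp add: suminf_mult[OF sum_mu])
  also have "\<dots> = (\<Sum>k. \<Sum>j\<le>n. l j * (c k * \<mu> (k + j)))"
    by (intro suminf_sum[symmetric] summable_mult sum_mu)
  also have "\<dots> = (\<Sum>k. T k)" by (simp only: inner)
  finally have val: "(\<Sum>j\<le>n. l j * (\<Sum>k. c k * \<mu> (k + j))) = (\<Sum>k. T k)" .
  have C1: "norm C < 1"
    unfolding C_def by (rule norm_mult_power_less_one[OF nQ ab1])
  obtain S where S:
    "(\<lambda>N. (-1) ^ N * Q ^ (N choose 2) * qpoch A Q N * z ^ N / (qpoch Q Q N * qpoch C Q N)) sums S"
    "(\<lambda>m. (Q ^ (m choose 2))\<^sup>2 * (\<Prod>i<m. A - C * Q ^ i) * z ^ m
        * qpoch_inf (z * Q ^ m) Q / (qpoch Q Q m * qpoch C Q m)) sums S"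
    using one_phi_one_transformation[OF q C1, of A z] unfolding Q_def by blast
  have "T (m + n) = D * ((Q ^ (m choose 2))\<^sup>2 * (\<Prod>i<m. A - C * Q ^ i) * z ^ m
        * qpoch_inf (z * Q ^ m) Q / (qpoch Q Q m * qpoch C Q m))" for m
    using shifted_term[OF q b1(2) t1 mu_Suc, of m n A]
    unfolding T_def c_def D_def C_def z_def Q_def .
  then have "(\<lambda>m. T (m + n)) sums (D * S)"
    using sums_mult[OF S(2), of D] by simp
  moreover have "(\<Sum>k<n. T k) = 0"
    by (intro sum.neutral) (auto simp: T_def qpoch_inverse_power_eq_0[OF Q0])
  ultimately have "T sums (D * S)"
    using sums_iff_shift[of T n "D * S"] by simp
  then have sumT: "(\<Sum>k. T k) = D * S" by (rule sums_unique[symmetric])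
  have S_eq: "qhyp [of_real (q powr (\<alpha> - \<beta>))] [of_real (q powr (\<alpha> + real n + 1))] (of_real q)
          (t * of_real (q ^ n)) = S"
  proof -
    have "complex_of_real (q powr (\<alpha> + real n + 1)) = of_real (q powr (\<alpha> + 1)) * of_real (q ^ n)"
      using q by (simp add: powr_realpow[symmetric] algebra_simps flip: of_real_mult powr_add)
    then have e: "complex_of_real (q powr (\<alpha> + real n + 1)) = C"
      by (simp add: a_eq C_def Q_def)
    have "qhyp [A] [C] Q z = (\<Sum>N. (-1) ^ N * Q ^ (N choose 2) * qpoch A Q N * z ^ N
        / (qpoch Q Q N * qpoch C Q N))"
      by (simp add: qhyp_def mult_ac)
    also have "\<dots> = S" using S(1) by (rule sums_unique[symmetric])
    finally show ?thesis unfolding e by (simp add: A_def z_def Q_def)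
  qed
  have D_eq: "- ((- t * of_real (q powr (\<alpha> - \<beta>))) ^ n) * of_real (q ^ (n choose 2))
      / (of_real (q ^ n) * qpoch_inf t (of_real q)
         * qpoch (of_real (q powr (\<alpha> + 1))) (of_real q) n) * S * qlag_factor q n \<beta> = D * S"
    unfolding qlag_factor_conv_0[OF q, of n \<beta>] D_def mu_0 a_eq
    by (simp add: A_def b_def Q_def mult_ac)
  show ?thesis
    using total' unfolding S_eq D_eq val sumT
    by (simp add: set_integrable_def set_lebesgue_integral_def has_bochner_integral_iff)
qed

end
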